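(* Let $\mathcal{X}:=\{u\in\mathcal{U}: \|u\|_{L^2}\le\rho\}$ be equipped with the (metrizable) weak topology of $L^2$. For every $N\ge 1$ let $\mathcal{F}^N:\mathcal{X}\to\mathbb{R}_+$ be $$\mathcal{F}^N(u):=\int_\Theta\int_0^1 a(t,x_u^\theta(t),\theta)\,d\nu(t)\,d\mu_N(\theta)+\frac{\beta}{2}\|u\|_{L^2}^2,$$ and let $\mathcal{F}:\mathcal{X}\to\mathbb{R}_+$ be the restriction to $\mathcal{X}$ of $$\mathcal{F}(u):=\int_\Theta\int_0^1 a(t,x_u^\theta(t),\theta)\,d\nu(t)\,d\mu(\theta)+\frac{\beta}{2}\|u\|_{L^2}^2 .$$ Then $\mathcal{F}^N$ $\Gamma$-converges to $\mathcal{F}$ on $\mathcal{X}$ (with respect to the weak topology of $L^2$) as $N\to\infty$.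
   Context: Let $n,k\ge 1$ and let $\Theta$ be a compact subset of a finite-dimensional Euclidean space. Let $F_0:\mathbb{R}^n\times\Theta\to\mathbb{R}^n$ and $F=(F_1,\dots,F_k):\mathbb{R}^n\times\Theta\to\mathbb{R}^{n\times k}$ ($F_i$ is the $i$-th column of $F$) be such that, for some $L>0$, $|F_i(x_1,\theta_1)-F_i(x_2,\theta_2)|_2\le L(|x_1-x_2|_2+|\theta_1-\theta_2|_2)$ for all $i=0,\dots,k$ and all $(x_1,\theta_1),(x_2,\theta_2)\in\mathbb{R}^n\times\Theta$. Let $x_0:\Theta\to\mathbb{R}^n$ be continuous. Set $\mathcal{U}:=L^2([0,1],\mathbb{R}^k)$. For $u\in\mathcal{U}$ and $\theta\in\Theta$, $x_u^\theta:[0,1]\to\mathbb{R}^n$ is the unique absolutely continuous solution of $\dot x(t)=F_0(x(t),\theta)+F(x(t),\theta)u(t)$ for a.e. $t\in[0,1]$, $x(0)=x_0(\theta)$. Let $a:[0,1]\times\mathbb{R}^n\times\Theta\to\mathbb{R}_+$ be continuous and non-negative, $\beta>0$, $\nu$ a Borel probability measure on $[0,1]$, $\mu$ a Borel probability measure on $\Theta$. For every $N\ge1$ let $\mu_N=\sum_{j=1}^N\alpha_j\delta_{\theta_j}$ with $\theta_1,\dots,\theta_N\in\Theta$, $\alpha_j>0$, $\sum_{j=1}^N\alpha_j=1$ (points and weights may depend on $N$), and assume $\mu_N\rightharpoonup^*\mu$, i.e. $\int_\Theta f\,d\mu_N\to\int_\Theta f\,d\mu$ for every $f\in C^0(\Theta,\mathbb{R})$.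 The number $\rho>0$ is fixed such that every $\hat u\in\mathcal{U}$ with $\mathcal{F}(\hat u)=\inf_{\mathcal{U}}\mathcal{F}$ satisfies $\|\hat u\|_{L^2}\le\rho$ (such a $\rho$ exists). $\Gamma$-convergence: for functionals $\mathcal{F}^N,\mathcal{F}:\mathcal{X}\to\mathbb{R}\cup\{+\infty\}$ on a metric space $\mathcal{X}$, $\mathcal{F}^N$ $\Gamma$-converges to $\mathcal{F}$ if (liminf) for every sequence $u_N\to u$ in $\mathcal{X}$ one has $\mathcal{F}(u)\le\liminf_{N\to\infty}\mathcal{F}^N(u_N)$, and (limsup) for every $u\in\mathcal{X}$ there is a sequence $u_N\to u$ in $\mathcal{X}$ with $\mathcal{F}(u)\ge\limsup_{N\to\infty}\mathcal{F}^N(u_N)$. *)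

theory Defs
  imports "HOL-Probability.Probability"
begin

section \<open>The space of controls\<close>

text \<open>
  Elements of \<open>L\<^sup>2([0,1], \<real>\<^sup>k)\<close> are represented by functions on \<open>real\<close>; only their values on
  \<open>[0,1]\<close>, and only up to null sets, enter any of the notions below. Functions that agree a.e. on
  \<open>[0,1]\<close> are topologically indistinguishable in \<open>weak_L2\<close> and have the same trajectories.
\<close>

definition L2_controls :: "(real \<Rightarrow> real ^ 'k) set" where
  "L2_controls = {u \<in> borel_measurable (lebesgue_on {0..1}).
                    integrable (lebesgue_on {0..1}) (\<lambda>t. (norm (u t))\<^sup>2)}"

definition L2_inner :: "(real \<Rightarrow> real ^ 'k) \<Rightarrow> (real \<Rightarrow> real ^ 'k) \<Rightarrow> real" where
  "L2_inner u v = (\<integral>t. u t \<bullet> v t \<partial>lebesgue_on {0..1})"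

definition L2_norm :: "(real \<Rightarrow> real ^ 'k) \<Rightarrow> real" where
  "L2_norm u = sqrt (\<integral>t. (norm (u t))\<^sup>2 \<partial>lebesgue_on {0..1})"

text \<open>
  The coarsest topology for which all \<open>\<langle>\<cdot>, v\<rangle>\<close> with \<open>v \<in> L\<^sup>2\<close> are continuous; by Riesz these are
  all continuous linear functionals.
\<close>

definition weak_L2 :: "(real \<Rightarrow> real ^ 'k) topology" where
  "weak_L2 = topology_generated_by
     {{u \<in> L2_controls. L2_inner u v \<in> S} | v S. v \<in> L2_controls \<and> open S}"

lemma zero_in_L2_controls: "(\<lambda>t. 0) \<in> L2_controls"
  by (simp add: L2_controls_def)

lemma topspace_weak_L2 [simp]: "topspace weak_L2 = L2_controls"
proof
  have "L2_controls = {u \<in> L2_controls. L2_inner u (\<lambda>t. 0) \<in> UNIV}" by simp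
  then have "L2_controls \<in> {{u \<in> L2_controls. L2_inner u v \<in> S} | v S. v \<in> L2_controls \<and> open S}"
    using zero_in_L2_controls by blast
  then show "L2_controls \<subseteq> topspace weak_L2"
    unfolding weak_L2_def topology_generated_by_topspace by blast
qed (auto simp: weak_L2_def)

lemma limitin_weak_L2:
  "limitin weak_L2 f u G \<longleftrightarrow>
     u \<in> L2_controls \<and> eventually (\<lambda>n. f n \<in> L2_controls) G \<and>
     (\<forall>v\<in>L2_controls. ((\<lambda>n. L2_inner (f n) v) \<longlongrightarrow> L2_inner u v) G)" (is "?lhs \<longleftrightarrow> ?rhs")
proof
  assume lim: ?lhs
  then have u: "u \<in> L2_controls"
    using limitin_topspace by fastforce
  have ev: "eventually (\<lambda>n. f n \<in> L2_controls \<and> L2_inner (f n) v \<in> S) G"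
    if "v \<in> L2_controls" "open S" "L2_inner u v \<in> S" for v S
  proof -
    have "openin weak_L2 {w \<in> L2_controls. L2_inner w v \<in> S}"
      unfolding weak_L2_def using that by (intro topology_generated_by_Basis) blast
    then show ?thesis
      using lim u that unfolding limitin_def by fastforce
  qed
  have "eventually (\<lambda>n. f n \<in> L2_controls) G"
    using ev[OF zero_in_L2_controls open_UNIV] by (simp add: eventually_conj_iff)
  moreover have "((\<lambda>n. L2_inner (f n) v) \<longlongrightarrow> L2_inner u v) G" if "v \<in> L2_controls" for v
    by (rule topological_tendstoI, drule (1) ev[OF that]) (auto elim: eventually_mono)
  ultimately show ?rhs using u by blast
next
  assume rhs: ?rhs
  have "eventually (\<lambda>n. f n \<in> U) G"
    if "generate_topology_on
          {{u \<in> L2_controls. L2_inner u v \<in> S} | v S. v \<in> L2_controls \<and> open S} U" "u \<in> U" for U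
    using that
  proof (induction rule: generate_topology_on.induct)
    case (Int a b)
    then show ?case by (auto intro: eventually_conj)
  next
    case (UN K)
    then obtain k where "k \<in> K" "u \<in> k" by blast
    with UN.IH have "eventually (\<lambda>n. f n \<in> k) G" by blast
    then show ?case by (rule eventually_mono) (use \<open>k \<in> K\<close> in blast)
  next
    case (Basis s)
    then obtain v S where s: "s = {w \<in> L2_controls. L2_inner w v \<in> S}"
        "v \<in> L2_controls" "open S" by blast
    with Basis rhs have "eventually (\<lambda>n. L2_inner (f n) v \<in> S) G"
      by (auto intro: topological_tendstoD)
    with rhs show ?case
      unfolding s by (auto intro: eventually_elim2)
  qed simp
  then show ?lhs
    using rhs by (simp add: limitin_def, simp add: weak_L2_def openin_topology_generated_by_iff)
qed

section \<open>Trajectories of the control system\<close>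

definition absolutely_continuous_fun :: "real set \<Rightarrow> (real \<Rightarrow> 'a::metric_space) \<Rightarrow> bool" where
  "absolutely_continuous_fun I x \<longleftrightarrow>
     (\<forall>\<epsilon>>0. \<exists>\<delta>>0. \<forall>(m::nat) s t.
        (\<forall>i<m. s i \<le> t i \<and> {s i..t i} \<subseteq> I) \<longrightarrow>
        disjoint_family_on (\<lambda>i. {s i<..<t i}) {..<m} \<longrightarrow>
        (\<Sum>i<m. t i - s i) < \<delta> \<longrightarrow>
        (\<Sum>i<m. dist (x (s i)) (x (t i))) < \<epsilon>)"

definition is_solution ::
  "(real ^ 'n \<Rightarrow> 'p \<Rightarrow> real ^ 'n) \<Rightarrow> (real ^ 'n \<Rightarrow> 'p \<Rightarrow> real ^ 'k ^ 'n) \<Rightarrow> ('p \<Rightarrow> real ^ 'n) \<Rightarrow>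
   (real \<Rightarrow> real ^ 'k) \<Rightarrow> 'p \<Rightarrow> (real \<Rightarrow> real ^ 'n) \<Rightarrow> bool" where
  "is_solution F0 F x0 u \<theta> x \<longleftrightarrow>
     absolutely_continuous_fun {0..1} x \<and>
     (AE t in lebesgue_on {0..1}.
        (x has_vector_derivative F0 (x t) \<theta> + F (x t) \<theta> *v u t) (at t within {0..1})) \<and>
     x 0 = x0 \<theta>"

text \<open>
  Solutions are functions on \<open>[0,1]\<close>; membership in \<open>extensional {0..1}\<close> fixes the irrelevant
  values outside, so that uniqueness on \<open>[0,1]\<close> makes the description definite.
\<close>

definition trajectory ::
  "(real ^ 'n \<Rightarrow> 'p \<Rightarrow> real ^ 'n) \<Rightarrow> (real ^ 'n \<Rightarrow> 'p \<Rightarrow> real ^ 'k ^ 'n) \<Rightarrow> ('p \<Rightarrow> real ^ 'n) \<Rightarrow>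
   (real \<Rightarrow> real ^ 'k) \<Rightarrow> 'p \<Rightarrow> real \<Rightarrow> real ^ 'n" where
  "trajectory F0 F x0 u \<theta> = (THE x. x \<in> extensional {0..1} \<and> is_solution F0 F x0 u \<theta> x)"

section \<open>Cost functionals\<close>

text \<open>
  \<open>ensemble_cost\<close> covers both functionals: the limit one with \<open>M = \<mu>\<close> and the approximating ones
  with \<open>M = \<mu>\<^sub>N\<close>. The measures \<open>\<nu>\<close> and \<open>M\<close> live on \<open>[0,1]\<close> and on \<open>\<Theta>\<close>, so the integrals need no
  explicit domain.
\<close>

definition ensemble_cost ::
  "(real ^ 'n \<Rightarrow> 'p \<Rightarrow> real ^ 'n) \<Rightarrow> (real ^ 'n \<Rightarrow> 'p \<Rightarrow> real ^ 'k ^ 'n) \<Rightarrow> ('p \<Rightarrow> real ^ 'n) \<Rightarrow>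
   (real \<Rightarrow> real ^ 'n \<Rightarrow> 'p \<Rightarrow> real) \<Rightarrow> real \<Rightarrow> real measure \<Rightarrow> 'p measure \<Rightarrow>
   (real \<Rightarrow> real ^ 'k) \<Rightarrow> real" where
  "ensemble_cost F0 F x0 a \<beta> \<nu> M u =
     (\<integral>\<theta>. (\<integral>t. a t (trajectory F0 F x0 u \<theta> t) \<theta> \<partial>\<nu>) \<partial>M) + \<beta> / 2 * (L2_norm u)\<^sup>2"

definition borel_prob_on :: "'a::topological_space set \<Rightarrow> 'a measure \<Rightarrow> bool" where
  "borel_prob_on S M \<longleftrightarrow> prob_space M \<and> sets M = sets (restrict_space borel S)"

definition atomic_measure ::
  "'p::topological_space set \<Rightarrow> nat \<Rightarrow> (nat \<Rightarrow> real) \<Rightarrow> (nat \<Rightarrow> 'p) \<Rightarrow> 'p measure" where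
  "atomic_measure \<Theta> N \<alpha> \<theta> =
     measure_of \<Theta> (sets (restrict_space borel \<Theta>))
       (\<lambda>A. \<Sum>j=1..N. ennreal (\<alpha> j) * emeasure (return (restrict_space borel \<Theta>) (\<theta> j)) A)"

lemma space_atomic_measure [simp]: "space (atomic_measure \<Theta> N \<alpha> \<theta>) = \<Theta>"
  unfolding atomic_measure_def
  using sets.space_closed[of "restrict_space borel \<Theta>"]
  by (subst space_measure_of) (simp_all add: space_restrict_space)

lemma sets_atomic_measure [simp]:
  "sets (atomic_measure \<Theta> N \<alpha> \<theta>) = sets (restrict_space borel \<Theta>)"
  unfolding atomic_measure_def
  using sets.sets_measure_of_eq[of "restrict_space borel \<Theta>"] by (simp add: space_restrict_space)

lemma emeasure_atomic_measure:
  assumes "A \<in> sets (restrict_space borel \<Theta>)"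
  shows "emeasure (atomic_measure \<Theta> N \<alpha> \<theta>) A =
    (\<Sum>j=1..N. ennreal (\<alpha> j) * emeasure (return (restrict_space borel \<Theta>) (\<theta> j)) A)"
  unfolding atomic_measure_def
proof (rule emeasure_measure_of_sigma)
  show "sigma_algebra \<Theta> (sets (restrict_space borel \<Theta>))"
    using sets.sigma_algebra_axioms[of "restrict_space borel \<Theta>"] by (simp add: space_restrict_space)
  show "countably_additive (sets (restrict_space borel \<Theta>))
     (\<lambda>A. \<Sum>j=1..N. ennreal (\<alpha> j) * emeasure (return (restrict_space borel \<Theta>) (\<theta> j)) A)"
    unfolding countably_additive_def
  proof (intro allI impI)
    fix A :: "nat \<Rightarrow> 'a set"
    assume A: "range A \<subseteq> sets (restrict_space borel \<Theta>)" "disjoint_family A"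
    have "(\<Sum>i. emeasure (return (restrict_space borel \<Theta>) (\<theta> j)) (A i)) =
        emeasure (return (restrict_space borel \<Theta>) (\<theta> j)) (\<Union>i. A i)" for j
      using A by (intro suminf_emeasure) (simp_all del: emeasure_return)
    then show "(\<Sum>i. \<Sum>j=1..N. ennreal (\<alpha> j) * emeasure (return (restrict_space borel \<Theta>) (\<theta> j)) (A i)) =
        (\<Sum>j=1..N. ennreal (\<alpha> j) * emeasure (return (restrict_space borel \<Theta>) (\<theta> j)) (\<Union>i. A i))"
      by (subst suminf_sum) (simp_all del: emeasure_return)
  qed
qed (use assms in \<open>auto simp: positive_def\<close>)

definition weak_star_converges ::
  "'p::topological_space set \<Rightarrow> (nat \<Rightarrow> 'p measure) \<Rightarrow> 'p measure \<Rightarrow> bool" where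
  "weak_star_converges \<Theta> \<mu>N \<mu> \<longleftrightarrow>
     (\<forall>f :: 'p \<Rightarrow> real. continuous_on \<Theta> f \<longrightarrow>
        (\<lambda>N. \<integral>\<theta>. f \<theta> \<partial>\<mu>N N) \<longlonglongrightarrow> (\<integral>\<theta>. f \<theta> \<partial>\<mu>))"

section \<open>Gamma-convergence\<close>

text \<open>The sequential notion, which is the usual one for (pseudo)metrizable topologies.\<close>

definition Gamma_converges ::
  "'a topology \<Rightarrow> (nat \<Rightarrow> 'a \<Rightarrow> ereal) \<Rightarrow> ('a \<Rightarrow> ereal) \<Rightarrow> bool" where
  "Gamma_converges X FN F \<longleftrightarrow>
     (\<forall>uN u. (\<forall>N. uN N \<in> topspace X) \<longrightarrow> limitin X uN u sequentially \<longrightarrow>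
        F u \<le> liminf (\<lambda>N. FN N (uN N))) \<and>
     (\<forall>u\<in>topspace X. \<exists>uN. (\<forall>N. uN N \<in> topspace X) \<and> limitin X uN u sequentially \<and>
        F u \<ge> limsup (\<lambda>N. FN N (uN N)))"

end

(*
  The functionals converge continuously along weakly convergent bounded controls, up to the norm term.
  If u_N -> u weakly, then x_N - x satisfies an integral inequality with an L^2 kernel bounded
  uniformly in N and forcing term int_0^t F(x,theta)(u_N - u) ds, where x is the trajectory of the
  limit control. The forcing term tends to 0 for each (t, theta) by weak convergence and is
  equicontinuous in (t, theta), hence tends to 0 uniformly, and Gronwall's inequality gives x_N -> x
  uniformly on [0,1] x Theta. So the running costs converge uniformly in theta to a continuous
  function, which passes to the limit against mu_N. Weak lower semicontinuity of the norm yields the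
  liminf inequality; the constant sequence is a recovery sequence.

  Trajectories are described by an almost everywhere derivative, so passing to and from the integral
  equation needs Lebesgue's differentiation theorem and the fundamental theorem of calculus for
  absolutely continuous functions. Both are proved with the gauge integral.
*)

theory Submission
  imports Defs
begin

section \<open>Absolutely continuous functions\<close>

text \<open>Both the integrand and the measure \<open>\<mu>N N\<close> change with N, while
  weak-star convergence handles only a fixed continuous integrand; this is why uniformity in the
  parameter is required throughout. The velocities are compared along the limit trajectory because
  there the factor multiplying the control difference does not depend on N and is a legitimate test
  function. The price is a Gronwall kernel built from the moving controls, of which only the L2
  norms are bounded. With such a kernel Gronwall is obtained by absorption: if K is at least twice
  the integral of its square, integration against it has norm at most 1/2 in the sup norm weighted
  by exp (- K t). The same estimate makes the Picard operator a contraction and so gives existence,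
  without which the definite description \<open>trajectory\<close> carries no information. Norms
  need not converge along weakly convergent controls; the penalty is handled by the affine minorant
  2 <v, u> - |u|^2 of |v|^2, which is weakly continuous in v and exact at v = u.\<close>

lemma absolutely_continuous_fun_tagged:
  fixes f :: "real \<Rightarrow> 'a::real_normed_vector"
  assumes "absolutely_continuous_fun {a..b} f" "e > 0"
  obtains \<delta> where "\<delta> > 0"
    "\<And>q. q tagged_partial_division_of {a..b} \<Longrightarrow> (\<Sum>(x,K)\<in>q. Sup K - Inf K) < \<delta> \<Longrightarrow>
         (\<Sum>(x,K)\<in>q. norm (f (Sup K) - f (Inf K))) < e"
proof -
  obtain \<delta> where "\<delta> > 0" and \<delta>: "\<And>(m::nat) s t. (\<forall>i<m. s i \<le> t i \<and> {s i..t i} \<subseteq> {a..b}) \<Longrightarrow>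
        disjoint_family_on (\<lambda>i. {s i<..<t i}) {..<m} \<Longrightarrow> (\<Sum>i<m. t i - s i) < \<delta> \<Longrightarrow>
        (\<Sum>i<m. dist (f (s i)) (f (t i))) < e"
    using assms unfolding absolutely_continuous_fun_def by meson
  show ?thesis
  proof (rule that[OF \<open>\<delta> > 0\<close>])
    fix q assume q: "q tagged_partial_division_of {a..b}" and small: "(\<Sum>(x,K)\<in>q. Sup K - Inf K) < \<delta>"
    note qD = tagged_partial_division_ofD[OF q]
    \<comment> \<open>The definition of absolute continuity speaks of families indexed by numbers,
      divisions are sets of tagged intervals; an enumeration of q translates one into the
      other.\<close>
    obtain h where h: "bij_betw h {..<card q} q"
      using ex_bij_betw_nat_finite[OF qD(1)] by (auto simp: atLeast0LessThan)
    define s t where "s = (\<lambda>i. Inf (snd (h i)))" and "t = (\<lambda>i. Sup (snd (h i)))"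
    have interval: "s i \<le> t i \<and> snd (h i) = {s i..t i}" if "i < card q" for i
    proof -
      have "h i \<in> q" using h that by (auto simp: bij_betw_def)
      then have mem: "(fst (h i), snd (h i)) \<in> q" by simp
      then obtain u v where uv: "snd (h i) = cbox u v" using qD(4) by blast
      moreover have "fst (h i) \<in> snd (h i)" using qD(2)[OF mem] .
      ultimately have "u \<le> v" by (simp add: box_real)
      then show ?thesis using uv by (simp add: s_def t_def box_real)
    qed
    have sub: "snd (h i) \<subseteq> {a..b}" if "i < card q" for i
    proof -
      have "h i \<in> q" using h that by (auto simp: bij_betw_def)
      then show ?thesis using qD(3)[of "fst (h i)" "snd (h i)"] by simp
    qed
    have "disjoint_family_on (\<lambda>i. {s i<..<t i}) {..<card q}"
      unfolding disjoint_family_on_def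
    proof (intro ballI impI)
      fix i j assume ij: "i \<in> {..<card q}" "j \<in> {..<card q}" "i \<noteq> j"
      then have "h i \<in> q" "h j \<in> q" "h i \<noteq> h j"
        using h by (auto simp: bij_betw_def inj_on_def)
      then have "interior (snd (h i)) \<inter> interior (snd (h j)) = {}"
        using qD(5)[of "fst (h i)" "snd (h i)" "fst (h j)" "snd (h j)"] by simp
      then show "{s i<..<t i} \<inter> {s j<..<t j} = {}"
        using interval[of i] interval[of j] ij by (simp add: interior_atLeastAtMost_real)
    qed
    moreover have sum_eq: "(\<Sum>(x,K)\<in>q. g K) = (\<Sum>i<card q. g (snd (h i)))" for g :: "real set \<Rightarrow> real"
      using sum.reindex_bij_betw[OF h, of "\<lambda>z. g (snd z)"] by (simp add: case_prod_unfold)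
    ultimately have "(\<Sum>i<card q. dist (f (s i)) (f (t i))) < e"
    proof (intro \<delta>)
      show "\<forall>i<card q. s i \<le> t i \<and> {s i..t i} \<subseteq> {a..b}"
        using interval sub by metis
      show "(\<Sum>i<card q. t i - s i) < \<delta>"
        using small unfolding sum_eq by (simp add: s_def t_def)
    qed
    then show "(\<Sum>(x,K)\<in>q. norm (f (Sup K) - f (Inf K))) < e"
      unfolding sum_eq by (simp add: s_def t_def dist_norm norm_minus_commute)
  qed
qed

text \<open>Intervals of a division meet only in null sets, so their lengths add up to the measure
  of their union. With U an open neighbourhood of the exceptional set, this meets the smallness
  condition in the definition of absolute continuity.\<close>

lemma sum_length_le_measure:
  assumes q: "q tagged_partial_division_of {a..b::real}" and sub: "\<And>x K. (x,K) \<in> q \<Longrightarrow> K \<subseteq> U"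
    and U: "U \<in> lmeasurable"
  shows "(\<Sum>(x,K)\<in>q. Sup K - Inf K) \<le> measure lebesgue U"
proof -
  note qD = tagged_partial_division_ofD[OF q]
  have interval: "\<exists>u v. u \<le> v \<and> snd z = {u..v}" if "z \<in> q" for z
  proof -
    have mem: "(fst z, snd z) \<in> q" using that by simp
    then obtain u v where "snd z = cbox u v" "fst z \<in> snd z" using qD(2,4) by blast
    then show ?thesis by (intro exI[of _ u] exI[of _ v]) (simp add: box_real)
  qed
  have "(\<Sum>(x,K)\<in>q. Sup K - Inf K) = (\<Sum>z\<in>q. measure lebesgue (snd z))"
    by (intro sum.cong refl) (use interval in fastforce)
  also have "\<dots> = measure lebesgue (\<Union>(snd ` q))"
  proof (rule measure_negligible_finite_Union_image[symmetric])
    show "pairwise (\<lambda>x y. negligible (snd x \<inter> snd y)) q"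
      unfolding pairwise_def
    proof (intro ballI impI)
      fix y z assume yz: "y \<in> q" "z \<in> q" "y \<noteq> z"
      then have "interior (snd y) \<inter> interior (snd z) = {}"
        using qD(5)[of "fst y" "snd y" "fst z" "snd z"] by simp
      moreover obtain u v u' v' where "snd y = {u..v}" "snd z = {u'..v'}"
        using interval yz by meson
      ultimately have "interior (snd y \<inter> snd z) = {}" "convex (snd y \<inter> snd z)"
        by (auto simp: interior_Int intro!: convex_Int)
      then show "negligible (snd y \<inter> snd z)"
        using negligible_convex_interior by blast
    qed
  qed (use qD(1) interval in fastforce)+
  also have "\<dots> \<le> measure lebesgue U"
  proof (rule measure_mono_fmeasurable)
    show "\<Union> (snd ` q) \<subseteq> U" using sub by fastforce
    show "\<Union> (snd ` q) \<in> sets lebesgue"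
      using qD(1) interval by (intro sets.finite_Union) fastforce+
  qed (rule U)
  finally show ?thesis .
qed

text \<open>
  The gauge forces intervals tagged in the exceptional set into an open superset of small measure,
  where absolute continuity makes the increments of \<open>f\<close> small; elsewhere the straddle estimate for
  derivatives applies.
\<close>

theorem absolutely_continuous_has_integral:
  fixes f :: "real \<Rightarrow> 'a::euclidean_space"
  assumes ac: "absolutely_continuous_fun {a..b} f" and "a \<le> b" and E: "negligible E"
    and der: "\<And>t. t \<in> {a..b} - E \<Longrightarrow> (f has_vector_derivative f' t) (at t within {a..b})"
  shows "(f' has_integral (f b - f a)) {a..b}"
proof -
  \<comment> \<open>At a tag in E the Riemann term is now zero, so only the increment of
    \<open>f\<close> is left to estimate there.\<close>
  define g where "g t = (if t \<in> E then 0 else f' t)" for t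
  have "(g has_integral (f b - f a)) {a..b}"
    unfolding has_integral_real
  proof (intro allI impI)
    fix e :: real assume "e > 0"
    \<comment> \<open>The straddle errors will total at most e / 4, next to less than e / 2 from the
      tags in E; the + 1 covers a = b.\<close>
    define e' where "e' = e / 4 / (b - a + 1)"
    have "e' > 0" using \<open>e > 0\<close> \<open>a \<le> b\<close> by (simp add: e'_def)
    have "e' * (b - a) \<le> e / 4"
      using \<open>e > 0\<close> \<open>a \<le> b\<close> by (simp add: e'_def divide_simps algebra_simps mult_nonneg_nonneg)
    obtain \<delta> where "\<delta> > 0" and \<delta>: "\<And>q. q tagged_partial_division_of {a..b} \<Longrightarrow>
        (\<Sum>(x,K)\<in>q. Sup K - Inf K) < \<delta> \<Longrightarrow> (\<Sum>(x,K)\<in>q. norm (f (Sup K) - f (Inf K))) < e / 2"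
      using absolutely_continuous_fun_tagged[OF ac, of "e/2"] \<open>e > 0\<close> by auto
    obtain U where U: "open U" "E \<subseteq> U" "U - E \<in> lmeasurable" "emeasure lebesgue (U - E) < ennreal \<delta>"
      using sets_lebesgue_outer_open[OF negligible_imp_sets[OF E] \<open>\<delta> > 0\<close>] .
    have Um: "U \<in> lmeasurable" "measure lebesgue U < \<delta>"
    proof -
      have UE: "U = (U - E) \<union> E" using U by auto
      show "U \<in> lmeasurable"
        using U(3) E by (subst UE) (intro fmeasurable.Un, auto simp: negligible_imp_measurable)
      have "measure lebesgue U \<le> measure lebesgue (U - E) + measure lebesgue E"
        using measure_Un_le[of "U - E" lebesgue E] U(3) E UE
        by (metis fmeasurableD negligible_imp_sets)
      also have "\<dots> = measure lebesgue (U - E)"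
        using E by (simp add: negligible_imp_measure0)
      also have "\<dots> < \<delta>"
        using U(3,4) \<open>\<delta> > 0\<close> by (simp add: emeasure_eq_measure2 ennreal_less_iff)
      finally show "measure lebesgue U < \<delta>" .
    qed
    have "\<exists>d>0. t \<in> {a..b} - E \<longrightarrow>
         (\<forall>y\<in>{a..b}. norm (y-t) < d \<longrightarrow> norm (f y - f t - (y-t) *\<^sub>R f' t) \<le> e' * norm (y-t))" for t
    proof (cases "t \<in> {a..b} - E")
      case True
      then show ?thesis
        using der[OF True, unfolded has_vector_derivative_def has_derivative_within_alt] \<open>e' > 0\<close>
        by blast
    qed (auto intro: exI[of _ 1])
    then obtain d where d0: "\<And>t. d t > 0" and
      d: "\<And>t y. t \<in> {a..b} - E \<Longrightarrow> y \<in> {a..b} \<Longrightarrow> norm (y-t) < d t \<Longrightarrow>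
            norm (f y - f t - (y-t) *\<^sub>R f' t) \<le> e' * norm (y-t)"
      by metis
    define \<gamma> where "\<gamma> t = (if t \<in> E then U else ball t (d t))" for t
    have gauge: "gauge \<gamma>"
      using U d0 by (auto simp: gauge_def \<gamma>_def)
    have sum_close: "norm (sum (\<lambda>(x,k). measure lborel k *\<^sub>R g x) p - (f b - f a)) < e"
      if p: "p tagged_division_of {a..b}" and fine: "\<gamma> fine p" for p
    proof -
      note pD = tagged_division_ofD[OF p]
      define pE where "pE = {z \<in> p. fst z \<in> E}"
      have pE: "pE \<subseteq> p" "finite pE" using pD(1) by (auto simp: pE_def)
      have pEt: "pE tagged_partial_division_of {a..b}"
        using p tagged_partial_division_subset[OF _ pE(1)] by (simp add: tagged_division_of_def)
      have "(\<Sum>(x,K)\<in>pE. Sup K - Inf K) \<le> measure lebesgue U"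
      proof (rule sum_length_le_measure[OF pEt])
        fix x K assume "(x, K) \<in> pE"
        then have "(x, K) \<in> p" "x \<in> E" by (auto simp: pE_def)
        then have "K \<subseteq> \<gamma> x" "\<gamma> x = U" using fineD[OF fine, of x K] by (auto simp: \<gamma>_def)
        then show "K \<subseteq> U" by simp
      qed (use Um in auto)
      then have part1: "(\<Sum>(x,K)\<in>pE. norm (f (Sup K) - f (Inf K))) < e / 2"
        using \<delta>[OF pEt] Um by linarith
      have int: "\<exists>u v. u \<le> v \<and> K = {u..v} \<and> u \<in> {a..b} \<and> v \<in> {a..b} \<and> x \<in> {u..v}" if mem: "(x,K) \<in> p" for x K
      proof -
        obtain u v where "K = {u..v}" using pD(4)[OF mem] by (auto simp: box_real)
        then show ?thesis using pD(2,3)[OF mem]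
          by (intro exI[of _ u] exI[of _ v]) auto
      qed
      have part2: "norm (measure lborel K *\<^sub>R g x - (f (Sup K) - f (Inf K))) \<le> e' * (Sup K - Inf K)"
        if mem: "(x,K) \<in> p - pE" for x K
      proof -
        obtain u v where uv: "u \<le> v" "K = {u..v}" "u \<in> {a..b}" "v \<in> {a..b}" "x \<in> {u..v}"
          using int mem by blast
        have xE: "x \<notin> E" "x \<in> {a..b}" using mem uv by (auto simp: pE_def)
        have "K \<subseteq> ball x (d x)"
          using fineD[OF fine, of x K] mem xE by (auto simp: \<gamma>_def)
        moreover have "u \<in> K" "v \<in> K" using uv by auto
        ultimately have "norm (u - x) < d x" "norm (v - x) < d x"
          by (auto simp: subset_iff dist_real_def abs_minus_commute)
        then have "norm (f u - f x - (u-x) *\<^sub>R f' x) \<le> e' * norm (u-x)"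
          "norm (f v - f x - (v-x) *\<^sub>R f' x) \<le> e' * norm (v-x)"
          using d[of x u] d[of x v] xE uv(3,4) by blast+
        \<comment> \<open>The tag lies between the endpoints: subtracting the two expansions cancels
          \<open>f x\<close>, and the two distances to the tag add up to v - u.\<close>
        then have "norm ((f u - f x - (u-x) *\<^sub>R f' x) - (f v - f x - (v-x) *\<^sub>R f' x))
            \<le> e' * norm (u-x) + e' * norm (v-x)"
          by (rule order_trans[OF norm_triangle_ineq4 add_mono])
        also have "\<dots> = e' * (v - u)"
          using uv by (simp add: algebra_simps)
        also have "(f u - f x - (u-x) *\<^sub>R f' x) - (f v - f x - (v-x) *\<^sub>R f' x)
            = (v - u) *\<^sub>R f' x - (f v - f u)"
          by (simp add: algebra_simps)
        finally show ?thesis using uv xE by (simp add: g_def)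
      qed
      have "sum (\<lambda>(x,k). measure lborel k *\<^sub>R g x) p - (f b - f a) =
          (\<Sum>(x,K)\<in>p. measure lborel K *\<^sub>R g x - (f (Sup K) - f (Inf K)))"
        using additive_tagged_division_1[OF \<open>a \<le> b\<close> p, of f]
        by (simp add: sum_subtractf case_prod_unfold)
      also have "\<dots> = (\<Sum>(x,K)\<in>p-pE. measure lborel K *\<^sub>R g x - (f (Sup K) - f (Inf K)))
           + (\<Sum>(x,K)\<in>pE. measure lborel K *\<^sub>R g x - (f (Sup K) - f (Inf K)))"
        using pE pD(1) by (simp add: sum.subset_diff)
      also have "norm \<dots> \<le> (\<Sum>(x,K)\<in>p-pE. e' * (Sup K - Inf K)) + (\<Sum>(x,K)\<in>pE. norm (f (Sup K) - f (Inf K)))"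
      proof (intro order_trans[OF norm_triangle_ineq] add_mono sum_norm_le)
        fix z assume "z \<in> p - pE"
        then show "norm (case z of (x, K) \<Rightarrow> measure lborel K *\<^sub>R g x - (f (Sup K) - f (Inf K)))
            \<le> (case z of (x, K) \<Rightarrow> e' * (Sup K - Inf K))"
          using part2[of "fst z" "snd z"] by (simp add: case_prod_unfold)
      qed (auto simp: pE_def g_def norm_minus_commute)
      also have "(\<Sum>(x,K)\<in>p-pE. e' * (Sup K - Inf K)) \<le> (\<Sum>(x,K)\<in>p. e' * (Sup K - Inf K))"
      proof (intro sum_mono2)
        fix z assume "z \<in> p - (p - pE)"
        then show "0 \<le> (case z of (x, K) \<Rightarrow> e' * (Sup K - Inf K))"
          using int[of "fst z" "snd z"] \<open>e' > 0\<close> by (auto simp: case_prod_unfold)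
      qed (use pD(1) in auto)
      also have "\<dots> = e' * (b - a)"
        using additive_tagged_division_1[OF \<open>a \<le> b\<close> p, of "\<lambda>x. x"]
        by (simp add: case_prod_unfold flip: sum_distrib_left)
      finally show ?thesis using part1 \<open>e' * (b - a) \<le> e / 4\<close> \<open>e > 0\<close> by linarith
    qed
    show "\<exists>\<gamma>. gauge \<gamma> \<and> (\<forall>p. p tagged_division_of {a..b} \<and> \<gamma> fine p \<longrightarrow>
        norm (sum (\<lambda>(x,k). measure lborel k *\<^sub>R g x) p - (f b - f a)) < e)"
      by (intro exI[of _ \<gamma>] conjI allI impI gauge) (erule conjE, rule sum_close)
  qed
  then show ?thesis
    by (rule has_integral_spike[OF E, rotated]) (auto simp: g_def)
qed

section \<open>Almost everywhere differentiation of indefinite integrals\<close>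

text \<open>
  The points where the difference quotients of the indefinite integral miss the integrand by more
  than \<open>\<eta>\<close> are Vitali covered by intervals on which the Riemann sum misses the integral by more than
  \<open>\<eta>\<close> times the length; by the Henstock lemma, disjoint intervals of this kind have small total length.
\<close>

lemma negligible_bad_difference_quotients:
  fixes f :: "real \<Rightarrow> 'a::euclidean_space"
  assumes f: "f integrable_on {a..b}" and "\<eta> > 0"
  shows "negligible {t \<in> {a..b}. \<forall>d>0. \<exists>s\<in>{a..b}. 0 < \<bar>s - t\<bar> \<and> \<bar>s - t\<bar> < d \<and>
           norm (integral {a..s} f - integral {a..t} f - (s - t) *\<^sub>R f t) > \<eta> * \<bar>s - t\<bar>}" (is "negligible ?B")
  unfolding negligible_outer_le
proof (intro allI impI)
  fix e :: real assume "e > 0"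
  \<comment> \<open>Each selected interval misses by more than \<eta> times its length, so a total
    Henstock error below e * \<eta> leaves total length at most e.\<close>
  have "e * \<eta> > 0" using \<open>e > 0\<close> \<open>\<eta> > 0\<close> by simp
  then obtain \<gamma> where "gauge \<gamma>" and \<gamma>: "\<And>p. \<lbrakk>p tagged_partial_division_of {a..b}; \<gamma> fine p\<rbrakk> \<Longrightarrow>
             (\<Sum>(x,K)\<in>p. norm (measure lborel K *\<^sub>R f x - integral K f)) < e * \<eta>"
    using Henstock_lemma[of f a b "e * \<eta>"] f by (auto simp: box_real)
  \<comment> \<open>Vitali's theorem is about balls: the pair (t, s) encodes the interval between a
    bad point t and its witness s as a ball. The point t, which may be either endpoint, is kept as
    the tag.\<close>
  define c r where "c = (\<lambda>(t,s). (t + s) / 2 :: real)" and "r = (\<lambda>(t,s). \<bar>s - t\<bar> / 2 :: real)"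
  define I where "I z = cball (c z) (r z)" for z
  have I_eq: "I (t,s) = {min t s..max t s}" for t s
    by (auto simp: I_def c_def r_def cball_eq_atLeastAtMost min_def max_def field_simps)
  define A where "A = {(t,s). t \<in> {a..b} \<and> s \<in> {a..b} \<and> s \<noteq> t \<and> I (t,s) \<subseteq> \<gamma> t \<and>
     norm (integral {a..s} f - integral {a..t} f - (s - t) *\<^sub>R f t) > \<eta> * \<bar>s - t\<bar>}"
  have A1: "0 < r z" if "z \<in> A" for z using that by (auto simp: A_def r_def)
  have A2: "\<exists>z. z \<in> A \<and> t \<in> cball (c z) (r z) \<and> r z < d" if t: "t \<in> ?B" and "0 < d" for t d
  proof -
    obtain d' where d': "d' > 0" "ball t d' \<subseteq> \<gamma> t"
      using \<open>gauge \<gamma>\<close> by (meson gauge_def open_contains_ball)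
    then have "min d d' > 0" using \<open>0 < d\<close> by simp
    then obtain s where s: "s \<in> {a..b}" "0 < \<bar>s - t\<bar>" "\<bar>s - t\<bar> < min d d'"
       "norm (integral {a..s} f - integral {a..t} f - (s - t) *\<^sub>R f t) > \<eta> * \<bar>s - t\<bar>"
      using t by blast
    have "I (t,s) \<subseteq> ball t d'"
      unfolding I_eq using s(3) by (auto simp: dist_real_def)
    then have "(t,s) \<in> A" using s t d' by (auto simp: A_def)
    moreover have "t \<in> I (t,s)" unfolding I_eq by simp
    moreover have "r (t,s) < d" using s(2,3) unfolding r_def by (simp, linarith)
    ultimately show ?thesis unfolding I_def by blast
  qed
  obtain C where "countable C" "C \<subseteq> A"
     "pairwise (\<lambda>i j. disjnt (cball (c i) (r i)) (cball (c j) (r j))) C"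
     "negligible (?B - (\<Union>i\<in>C. cball (c i) (r i)))"
    by (rule Vitali_covering_theorem_cballs[of A r ?B c, OF A1 A2])
  note C = this[folded I_def]
  \<comment> \<open>A bound uniform over finite subfamilies passes to the countable union, and only
    finite families form tagged divisions.\<close>
  have bound: "measure lebesgue (\<Union>i\<in>D. I i) \<le> e" if D: "D \<subseteq> C" "finite D" for D
  proof -
    define p where "p = (\<lambda>z. (fst z, I z)) ` D"
    have disj: "I y \<inter> I z = {}" if "y \<in> D" "z \<in> D" "y \<noteq> z" for y z
      using C(3) D that unfolding pairwise_def disjnt_def by blast
    have mem: "fst z \<in> I z" for z
      using I_eq[of "fst z" "snd z"] by simp
    have inj: "inj_on (\<lambda>z. (fst z, I z)) D"
    proof (rule inj_onI, rule ccontr)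
      fix y z assume "y \<in> D" "z \<in> D" "(fst y, I y) = (fst z, I z)" "y \<noteq> z"
      then show False using disj[of y z] mem[of y] by auto
    qed
    have DA: "z \<in> A" if "z \<in> D" for z using D C that by blast
    have "p tagged_partial_division_of {a..b}"
      unfolding tagged_partial_division_of_def
    proof (intro conjI allI impI)
      show "finite p" using D by (simp add: p_def)
      fix x K assume xK: "(x,K) \<in> p"
      then obtain z where z: "z \<in> D" "x = fst z" "K = I z" by (auto simp: p_def)
      then have "(fst z, snd z) \<in> A" using DA by simp
      then have "a \<le> fst z" "fst z \<le> b" "a \<le> snd z" "snd z \<le> b" by (auto simp: A_def)
      moreover have K: "K = {min (fst z) (snd z)..max (fst z) (snd z)}"
        using z I_eq[of "fst z" "snd z"] by simp
      ultimately show "x \<in> K" "K \<subseteq> {a..b}"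
        using z by auto
      show "\<exists>a b. K = cbox a b" using K by (metis box_real(2))
    next
      fix x K x' K' assume xK: "(x,K) \<in> p \<and> (x',K') \<in> p \<and> (x,K) \<noteq> (x',K')"
      then obtain z where z: "z \<in> D" "x = fst z" "K = I z" by (auto simp: p_def)
      then obtain z' where "z' \<in> D" "x' = fst z'" "K' = I z'" "z \<noteq> z'" using xK by (auto simp: p_def)
      then have "K \<inter> K' = {}" using disj z by auto
      then show "interior K \<inter> interior K' = {}"
        using interior_subset by blast
    qed
    moreover have "\<gamma> fine p"
      unfolding fine_def p_def using DA by (force simp: A_def)
    ultimately have "(\<Sum>(x,K)\<in>p. norm (measure lborel K *\<^sub>R f x - integral K f)) < e * \<eta>"
      by (rule \<gamma>)
    then have "(\<Sum>z\<in>D. norm (measure lborel (I z) *\<^sub>R f (fst z) - integral (I z) f)) < e * \<eta>"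
      unfolding p_def by (subst (asm) sum.reindex[OF inj]) (simp add: case_prod_unfold)
    moreover have "(\<Sum>z\<in>D. measure lebesgue (I z) * \<eta>) \<le>
        (\<Sum>z\<in>D. norm (measure lborel (I z) *\<^sub>R f (fst z) - integral (I z) f))"
    proof (rule sum_mono)
      fix z assume "z \<in> D"
      obtain t s where z: "z = (t,s)" by fastforce
      then have ts: "t \<in> {a..b}" "s \<in> {a..b}"
        "norm (integral {a..s} f - integral {a..t} f - (s - t) *\<^sub>R f t) > \<eta> * \<bar>s - t\<bar>"
        using DA[OF \<open>z \<in> D\<close>] by (auto simp: A_def)
      have combine: "integral {u..v} f = integral {a..v} f - integral {a..u} f"
        if "u \<le> v" "u \<in> {a..b}" "v \<in> {a..b}" for u v
        using Henstock_Kurzweil_Integration.integral_combine[of a u v f] that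
          integrable_on_subinterval[OF f, of a v] by (simp add: algebra_simps)
      have "measure lebesgue (I z) = \<bar>s - t\<bar>" "measure lborel (I z) = \<bar>s - t\<bar>"
        unfolding z I_eq by (auto simp: min_def max_def)
      moreover have "norm (\<bar>s - t\<bar> *\<^sub>R f t - integral (I z) f) =
          norm (integral {a..s} f - integral {a..t} f - (s - t) *\<^sub>R f t)"
      proof (cases "t \<le> s")
        case True
        then show ?thesis using combine[of t s] ts
          by (simp add: z I_eq norm_minus_commute min_def max_def)
      next
        case False
        then have "integral (I z) f = integral {a..t} f - integral {a..s} f" and abs: "\<bar>s - t\<bar> = t - s"
          using combine[of s t] ts by (auto simp: z I_eq min_def max_def)
        then show ?thesis unfolding \<open>integral (I z) f = _\<close> abs by (simp add: algebra_simps)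
      qed
      ultimately show "measure lebesgue (I z) * \<eta> \<le> norm (measure lborel (I z) *\<^sub>R f (fst z) - integral (I z) f)"
        using ts by (simp add: z mult.commute)
    qed
    ultimately have "(\<Sum>z\<in>D. measure lebesgue (I z)) * \<eta> \<le> e * \<eta>"
      by (simp add: sum_distrib_right)
    then have "(\<Sum>z\<in>D. measure lebesgue (I z)) \<le> e" using \<open>\<eta> > 0\<close> by simp
    moreover have "measure lebesgue (\<Union>i\<in>D. I i) \<le> (\<Sum>z\<in>D. measure lebesgue (I z))"
      using D by (intro measure_UNION_le) (auto simp: I_def)
    ultimately show ?thesis by linarith
  qed
  have meas: "I i \<in> lmeasurable" for i by (simp add: I_def)
  have un: "(\<Union>i\<in>C. I i) \<in> lmeasurable" "measure lebesgue (\<Union>i\<in>C. I i) \<le> e"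
    using fmeasurable_UN_bound[OF C(1) meas bound] measure_UN_bound[OF C(1) meas bound] by auto
  show "\<exists>T. ?B \<subseteq> T \<and> T \<in> lmeasurable \<and> measure lebesgue T \<le> e"
  proof (intro exI conjI)
    let ?T = "(\<Union>i\<in>C. I i) \<union> (?B - (\<Union>i\<in>C. I i))"
    show "?B \<subseteq> ?T" by blast
    show "?T \<in> lmeasurable" by (rule fmeasurable.Un[OF un(1) negligible_imp_measurable[OF C(4)]])
    have "measure lebesgue ?T \<le> measure lebesgue (\<Union>i\<in>C. I i) + measure lebesgue (?B - (\<Union>i\<in>C. I i))"
      using un C(4) by (intro measure_Un_le) (auto intro: negligible_imp_sets)
    then show "measure lebesgue ?T \<le> e"
      using un negligible_imp_measure0[OF C(4)] by linarith
  qed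
qed

text \<open>A point where the derivative fails is bad for some tolerance 1 / (n + 1), so countably
  many null sets cover all of them.\<close>

theorem negligible_not_has_vector_derivative_integral:
  fixes f :: "real \<Rightarrow> 'a::euclidean_space"
  assumes f: "f integrable_on {a..b}"
  shows "negligible {t \<in> {a..b}. \<not> ((\<lambda>u. integral {a..u} f) has_vector_derivative f t) (at t within {a..b})}"
proof -
  define B where "B \<eta> = {t \<in> {a..b}. \<forall>d>0. \<exists>s\<in>{a..b}. 0 < \<bar>s - t\<bar> \<and> \<bar>s - t\<bar> < d \<and>
           norm (integral {a..s} f - integral {a..t} f - (s - t) *\<^sub>R f t) > \<eta> * \<bar>s - t\<bar>}" for \<eta>
  have "negligible (\<Union>n. B (inverse (real (Suc n))))"
    unfolding B_def by (intro negligible_Union_nat negligible_bad_difference_quotients[OF f]) simp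
  moreover have "{t \<in> {a..b}. \<not> ((\<lambda>u. integral {a..u} f) has_vector_derivative f t) (at t within {a..b})}
      \<subseteq> (\<Union>n. B (inverse (real (Suc n))))"
  proof (rule subsetI, rule ccontr)
    fix t assume t0: "t \<in> {t \<in> {a..b}. \<not> ((\<lambda>u. integral {a..u} f) has_vector_derivative f t) (at t within {a..b})}"
      and notin: "t \<notin> (\<Union>n. B (inverse (real (Suc n))))"
    then have t: "t \<in> {a..b}" by simp
    have "((\<lambda>u. integral {a..u} f) has_vector_derivative f t) (at t within {a..b})"
      unfolding has_vector_derivative_def has_derivative_within_alt
    proof (intro conjI allI impI)
      show "bounded_linear (\<lambda>h. h *\<^sub>R f t)" by (rule bounded_linear_scaleR_left)
      fix e :: real assume "e > 0"
      then obtain n where n: "inverse (real (Suc n)) < e" using reals_Archimedean by blast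
      have "t \<notin> B (inverse (real (Suc n)))" using notin by blast
      then obtain d where d: "d > 0" "\<And>s. s \<in> {a..b} \<Longrightarrow> 0 < \<bar>s - t\<bar> \<Longrightarrow> \<bar>s - t\<bar> < d \<Longrightarrow>
           norm (integral {a..s} f - integral {a..t} f - (s - t) *\<^sub>R f t) \<le> inverse (real (Suc n)) * \<bar>s - t\<bar>"
        using t unfolding B_def by (fastforce simp: not_less)
      show "\<exists>d>0. \<forall>y\<in>{a..b}. norm (y - t) < d \<longrightarrow>
          norm (integral {a..y} f - integral {a..t} f - (y - t) *\<^sub>R f t) \<le> e * norm (y - t)"
      proof (intro exI conjI ballI impI)
        fix y assume y: "y \<in> {a..b}" "norm (y - t) < d"
        show "norm (integral {a..y} f - integral {a..t} f - (y - t) *\<^sub>R f t) \<le> e * norm (y - t)"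
        proof (cases "y = t")
          case False
          then have "norm (integral {a..y} f - integral {a..t} f - (y - t) *\<^sub>R f t) \<le> inverse (real (Suc n)) * \<bar>y - t\<bar>"
            using y d by auto
          also have "\<dots> \<le> e * \<bar>y - t\<bar>" using n by (intro mult_right_mono) auto
          finally show ?thesis by simp
        qed simp
      qed (rule d)
    qed
    then show False using t0 by simp
  qed
  ultimately show ?thesis by (rule negligible_subset)
qed

section \<open>Square integrable kernels\<close>

lemma continuous_times_absolutely_integrable:
  fixes c :: "real \<Rightarrow> real"
  assumes "c absolutely_integrable_on {a..b}" "continuous_on {a..b} z"
  shows "(\<lambda>s. c s * z s) absolutely_integrable_on {a..b}"
proof -
  have "(\<lambda>s. z s * c s) absolutely_integrable_on {a..b}"
  proof (rule absolutely_integrable_bounded_measurable_product[OF bilinear_times])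
    show "z \<in> borel_measurable (lebesgue_on {a..b})"
      using assms(2) by (rule continuous_imp_measurable_on_sets_lebesgue) auto
    show "bounded (z ` {a..b})"
      using assms(2) compact_continuous_image compact_imp_bounded by blast
  qed (use assms in auto)
  then show ?thesis by (simp add: mult.commute)
qed

text \<open>Young's inequality replaces the Cauchy--Schwarz inequality throughout.\<close>

lemma integral_le_young:
  fixes f :: "real \<Rightarrow> real"
  assumes "f integrable_on {a..b}" "(\<lambda>t. (f t)\<^sup>2) integrable_on {a..b}" "l > 0" "a \<le> b"
  shows "integral {a..b} f \<le> l / 2 * (b - a) + integral {a..b} (\<lambda>t. (f t)\<^sup>2) / (2 * l)"
proof -
  have "f t \<le> l / 2 + (f t)\<^sup>2 / (2 * l)" for t
    using sum_squares_ge_zero[of "f t - l" 0] \<open>l > 0\<close>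
    by (simp add: field_simps power2_eq_square)
  then have "integral {a..b} f \<le> integral {a..b} (\<lambda>t. l / 2 + (f t)\<^sup>2 / (2 * l))"
    using assms by (intro integral_le integrable_add integrable_on_divide) auto
  also have "\<dots> = l / 2 * (b - a) + integral {a..b} (\<lambda>t. (f t)\<^sup>2) / (2 * l)"
    using assms by (subst Henstock_Kurzweil_Integration.integral_add)
      (auto intro!: integrable_on_divide)
  finally show ?thesis .
qed

text \<open>Integration against \<open>c\<close> halves the sup norm weighted by exp (- K t). It is
  Young's inequality for the product of \<open>c\<close> and the exponential, and it serves both the
  Gronwall estimate and the contraction proof.\<close>

lemma integral_exp_weight_le:
  fixes c :: "real \<Rightarrow> real"
  assumes c: "c absolutely_integrable_on {0..1}" "(\<lambda>t. (c t)\<^sup>2) integrable_on {0..1}"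
    and K: "K > 0" "integral {0..1} (\<lambda>t. (c t)\<^sup>2) \<le> K / 2" and t: "t \<in> {0..1}"
  shows "integral {0..t} (\<lambda>s. c s * exp (K * s)) \<le> exp (K * t) / 2"
proof -
  \<comment> \<open>This choice balances Young's inequality: each of the two terms is then at most
    exp (K * t) / 4.\<close>
  define l where "l = exp (K * t) / K"
  have "l > 0" using K by (simp add: l_def)
  have sub: "{0..t} \<subseteq> {0..1}" using t by auto
  have c2: "(\<lambda>t. (c t)\<^sup>2) integrable_on {0..t}"
    using c(2) sub integrable_on_subinterval by blast
  have c1: "(\<lambda>s. c s * exp (K * s)) integrable_on {0..t}"
    using c(1) sub by (intro set_lebesgue_integral_eq_integral(1) continuous_times_absolutely_integrable)
      (auto intro: absolutely_integrable_on_subinterval continuous_intros)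
  have e: "((\<lambda>s. exp (2 * K * s)) has_integral (exp (2 * K * t) / (2 * K) - exp (2 * K * 0) / (2 * K))) {0..t}"
    using t K by (intro fundamental_theorem_of_calculus)
      (auto intro!: derivative_eq_intros simp: has_real_derivative_iff_has_vector_derivative[symmetric])
  then have e1: "(\<lambda>s. exp (2 * K * s)) integrable_on {0..t}"
    and e2: "integral {0..t} (\<lambda>s. exp (2 * K * s)) \<le> exp (2 * K * t) / (2 * K)"
    using K by (auto simp: integral_unique)
  have pointwise: "c s * exp (K * s) \<le> l / 2 * (c s)\<^sup>2 + 1 / (2 * l) * exp (2 * K * s)" for s
  proof -
    have "exp (2 * K * s) = (exp (K * s))\<^sup>2"
      by (simp add: power2_eq_square flip: exp_add)
    moreover have "0 \<le> (l * c s - exp (K * s))\<^sup>2" by simp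
    ultimately show ?thesis
      using \<open>l > 0\<close> by (simp add: field_simps power2_eq_square)
  qed
  have "integral {0..t} (\<lambda>s. c s * exp (K * s)) \<le>
      integral {0..t} (\<lambda>s. l / 2 * (c s)\<^sup>2 + 1 / (2 * l) * exp (2 * K * s))"
    using c1 c2 e1 pointwise by (intro integral_le integrable_add integrable_on_mult_right) auto
  also have "\<dots> = l / 2 * integral {0..t} (\<lambda>t. (c t)\<^sup>2) + 1 / (2 * l) * integral {0..t} (\<lambda>s. exp (2 * K * s))"
    using c2 integrable_on_mult_right[OF e1, of "1 / (2 * l)"]
    by (subst Henstock_Kurzweil_Integration.integral_add) (auto intro!: integrable_on_mult_right)
  also have "\<dots> \<le> l / 2 * (K / 2) + 1 / (2 * l) * (exp (2 * K * t) / (2 * K))"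
  proof (intro add_mono mult_left_mono e2)
    have "integral {0..t} (\<lambda>t. (c t)\<^sup>2) \<le> integral {0..1} (\<lambda>t. (c t)\<^sup>2)"
      using c2 c(2) sub by (intro integral_subset_le) auto
    then show "integral {0..t} (\<lambda>t. (c t)\<^sup>2) \<le> K / 2" using K by linarith
  qed (use \<open>l > 0\<close> in auto)
  also have "\<dots> = exp (K * t) / 2"
  proof -
    have "exp (2 * K * t) = exp (K * t) * exp (K * t)"
      by (simp flip: exp_add)
    then show ?thesis using K by (simp add: l_def)
  qed
  finally show ?thesis .
qed

text \<open>Let S be the maximum of z t * exp (- K * t). At a point where it is attained, the
  integral inequality returns S with the factor 1/2, which is absorbed on the left; removing the
  weight costs the factor exp K.\<close>

lemma gronwall_L2:
  fixes c z :: "real \<Rightarrow> real"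
  assumes c: "c absolutely_integrable_on {0..1}" "(\<lambda>t. (c t)\<^sup>2) integrable_on {0..1}"
    and c0: "\<And>t. c t \<ge> 0"
    and K: "K > 0" "integral {0..1} (\<lambda>t. (c t)\<^sup>2) \<le> K / 2"
    and z: "continuous_on {0..1} z" "\<And>t. t \<in> {0..1} \<Longrightarrow> z t \<le> A + integral {0..t} (\<lambda>s. c s * z s)"
    and z0: "\<And>t. t \<in> {0..1} \<Longrightarrow> z t \<ge> 0" and t: "t \<in> {0..1}"
  shows "z t \<le> 2 * A * exp K"
proof -
  have "continuous_on {0..1} (\<lambda>t. z t * exp (- K * t))"
    using z(1) by (intro continuous_intros)
  then obtain t1 where t1: "t1 \<in> {0..1}"
     "\<And>t. t \<in> {0..1} \<Longrightarrow> z t * exp (- K * t) \<le> z t1 * exp (- K * t1)"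
    using continuous_attains_sup[of "{0..1::real}" "\<lambda>t. z t * exp (- K * t)"] by auto
  define S where "S = z t1 * exp (- K * t1)"
  have zS: "z t \<le> S * exp (K * t)" if "t \<in> {0..1}" for t
    using t1(2)[OF that] by (simp add: S_def exp_minus field_simps)
  have S0: "S \<ge> 0" using z0[OF t1(1)] by (simp add: S_def)
  have sub: "{0..t1} \<subseteq> {0..1}" using t1 by auto
  have c': "c absolutely_integrable_on {0..t1}"
    using c(1) sub absolutely_integrable_on_subinterval by blast
  have "z t1 \<le> A + integral {0..t1} (\<lambda>s. c s * z s)" using z(2) t1 by auto
  also have "integral {0..t1} (\<lambda>s. c s * z s) \<le> integral {0..t1} (\<lambda>s. S * (c s * exp (K * s)))"
  proof (rule integral_le)
    show "(\<lambda>s. c s * z s) integrable_on {0..t1}"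
      using c' z(1) sub by (intro set_lebesgue_integral_eq_integral(1) continuous_times_absolutely_integrable)
        (auto intro: continuous_on_subset)
    show "(\<lambda>s. S * (c s * exp (K * s))) integrable_on {0..t1}"
      using c' by (intro integrable_on_mult_right set_lebesgue_integral_eq_integral(1)
        continuous_times_absolutely_integrable) (auto intro: continuous_intros)
    fix s assume "s \<in> {0..t1}"
    then have "s \<in> {0..1}" using sub by blast
    then show "c s * z s \<le> S * (c s * exp (K * s))"
      using mult_left_mono[OF zS[of s] c0[of s]] by (simp add: mult_ac)
  qed
  also have "\<dots> = S * integral {0..t1} (\<lambda>s. c s * exp (K * s))" by simp
  also have "\<dots> \<le> S * (exp (K * t1) / 2)"
    by (intro mult_left_mono integral_exp_weight_le c K t1 S0)
  finally have "z t1 \<le> A + S * exp (K * t1) / 2" by simp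
  then have "S \<le> (A + S * exp (K * t1) / 2) * exp (- K * t1)"
    unfolding S_def by (intro mult_right_mono) auto
  also have "\<dots> = A * exp (- K * t1) + S / 2"
    by (simp add: algebra_simps exp_minus)
  finally have S2: "S \<le> 2 * A * exp (- K * t1)" by simp
  \<comment> \<open>The sign of A follows from that of S and permits replacing exp (- K * t1) by
    1.\<close>
  then have "A \<ge> 0" using S0 by (smt (verit) mult_neg_pos exp_gt_zero)
  moreover have "exp (- K * t1) \<le> 1" using K t1 by simp
  ultimately have "S \<le> 2 * A"
    using S2 mult_left_le[of "exp (- K * t1)" "2 * A"] by simp
  have "z t \<le> S * exp (K * t)" using zS t by blast
  also have "\<dots> \<le> 2 * A * exp K"
    using \<open>S \<le> 2 * A\<close> \<open>A \<ge> 0\<close> K t by (intro mult_mono) auto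
  finally show ?thesis .
qed

text \<open>A square integrable majorant makes \<delta> explicit: by Young's inequality the
  increments sum to at most l / 2 times the total length plus N / (2 * l), because the integrals of
  the square over nonoverlapping intervals add up to at most N.\<close>

lemma absolutely_continuous_integral:
  fixes h :: "real \<Rightarrow> 'a::euclidean_space" and g :: "real \<Rightarrow> real"
  assumes h: "h integrable_on {a..b}" and g: "g integrable_on {a..b}" "(\<lambda>t. (g t)\<^sup>2) integrable_on {a..b}"
    and hg: "\<And>t. t \<in> {a..b} \<Longrightarrow> norm (h t) \<le> g t"
  shows "absolutely_continuous_fun {a..b} (\<lambda>t. y + integral {a..t} h)"
  unfolding absolutely_continuous_fun_def
proof (intro allI impI)
  fix e :: real assume "e > 0"
  define N where "N = integral {a..b} (\<lambda>t. (g t)\<^sup>2)"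
  have "N \<ge> 0" unfolding N_def by (rule Henstock_Kurzweil_Integration.integral_nonneg) (use g in auto)
  \<comment> \<open>This makes N / (2 * l) smaller than e / 2, and total length below e / l keeps
    the other term at most e / 2. The + 1 keeps l positive when N = 0.\<close>
  define l where "l = (N + 1) / e"
  have "l > 0" using \<open>e > 0\<close> \<open>N \<ge> 0\<close> by (simp add: l_def)
  have Nl: "N / (2 * l) < e / 2"
    using \<open>e > 0\<close> \<open>N \<ge> 0\<close> by (simp add: l_def field_simps)
  show "\<exists>\<delta>>0. \<forall>(m::nat) s t. (\<forall>i<m. s i \<le> t i \<and> {s i..t i} \<subseteq> {a..b}) \<longrightarrow>
        disjoint_family_on (\<lambda>i. {s i<..<t i}) {..<m} \<longrightarrow> (\<Sum>i<m. t i - s i) < \<delta> \<longrightarrow>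
        (\<Sum>i<m. dist (y + integral {a..s i} h) (y + integral {a..t i} h)) < e"
  proof (intro exI[of _ "e / l"] conjI allI impI)
    show "e / l > 0" using \<open>e > 0\<close> \<open>l > 0\<close> by simp
    fix m :: nat and s t :: "nat \<Rightarrow> real"
    assume st: "\<forall>i<m. s i \<le> t i \<and> {s i..t i} \<subseteq> {a..b}"
      and disj: "disjoint_family_on (\<lambda>i. {s i<..<t i}) {..<m}"
      and small: "(\<Sum>i<m. t i - s i) < e / l"
    have g2i: "(\<lambda>t. (g t)\<^sup>2) integrable_on {s i..t i}" if "i < m" for i
      using g(2) st that integrable_on_subinterval by blast
    have "dist (y + integral {a..s i} h) (y + integral {a..t i} h) \<le>
        l / 2 * (t i - s i) + integral {s i..t i} (\<lambda>t. (g t)\<^sup>2) / (2 * l)" if i: "i < m" for i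
    proof -
      have sti: "s i \<le> t i" "a \<le> s i" "t i \<le> b" "{s i..t i} \<subseteq> {a..b}" using st i by auto
      have "integral {a..s i} h + integral {s i..t i} h = integral {a..t i} h"
        using sti integrable_on_subinterval[OF h, of a "t i"]
        by (intro Henstock_Kurzweil_Integration.integral_combine) auto
      then have "dist (y + integral {a..s i} h) (y + integral {a..t i} h) = norm (integral {s i..t i} h)"
        by (simp add: dist_norm flip: \<open>_ = integral {a..t i} h\<close>)
      also have "\<dots> \<le> integral {s i..t i} g"
        using h g(1) sti hg by (intro integral_norm_bound_integral)
          (auto intro: integrable_on_subinterval)
      also have "\<dots> \<le> l / 2 * (t i - s i) + integral {s i..t i} (\<lambda>t. (g t)\<^sup>2) / (2 * l)"
        using integrable_on_subinterval[OF g(1)] g2i[OF i] sti \<open>l > 0\<close> by (intro integral_le_young) auto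
      finally show ?thesis .
    qed
    then have "(\<Sum>i<m. dist (y + integral {a..s i} h) (y + integral {a..t i} h)) \<le>
        (\<Sum>i<m. l / 2 * (t i - s i) + integral {s i..t i} (\<lambda>t. (g t)\<^sup>2) / (2 * l))"
      by (intro sum_mono) auto
    also have "\<dots> = l / 2 * (\<Sum>i<m. t i - s i) + (\<Sum>i<m. integral {s i..t i} (\<lambda>t. (g t)\<^sup>2)) / (2 * l)"
      by (simp add: sum.distrib sum_distrib_left sum_divide_distrib)
    also have "(\<Sum>i<m. integral {s i..t i} (\<lambda>t. (g t)\<^sup>2)) = integral (\<Union>i<m. {s i..t i}) (\<lambda>t. (g t)\<^sup>2)"
    proof (rule integral_unique[symmetric], rule has_integral_UN)
      show "pairwise (\<lambda>i j. negligible ({s i..t i} \<inter> {s j..t j})) {..<m}"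
        unfolding pairwise_def
      proof (intro ballI impI)
        fix i j assume "i \<in> {..<m}" "j \<in> {..<m}" "i \<noteq> j"
        then have "interior ({s i..t i} \<inter> {s j..t j}) = {}"
          using disj by (simp add: disjoint_family_on_def interior_Int interior_atLeastAtMost_real)
        then show "negligible ({s i..t i} \<inter> {s j..t j})"
          by (subst negligible_convex_interior) (auto intro: convex_Int)
      qed
    qed (use g2i in auto)
    also have "\<dots> \<le> N"
      unfolding N_def
    proof (rule integral_subset_le)
      show "(\<lambda>t. (g t)\<^sup>2) integrable_on (\<Union>i<m. {s i..t i})"
      proof (rule set_lebesgue_integral_eq_integral(1), rule set_integrable_subset)
        show "(\<lambda>t. (g t)\<^sup>2) absolutely_integrable_on {a..b}"
          using g(2) by (intro nonnegative_absolutely_integrable_1) auto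
      qed (use st in auto)
    qed (use g st in auto)
    also have "l / 2 * (\<Sum>i<m. t i - s i) + N / (2 * l) < e"
    proof -
      have "l / 2 * (\<Sum>i<m. t i - s i) \<le> l / 2 * (e / l)"
        using small \<open>l > 0\<close> by (intro mult_left_mono) auto
      then show ?thesis using Nl \<open>l > 0\<close> by simp
    qed
    finally show "(\<Sum>i<m. dist (y + integral {a..s i} h) (y + integral {a..t i} h)) < e"
      using \<open>l > 0\<close> by (simp add: divide_right_mono)
  qed
qed

section \<open>Elementary properties of absolutely continuous functions\<close>

lemma absolutely_continuous_fun_imp_continuous_on:
  fixes f :: "real \<Rightarrow> 'a::metric_space"
  assumes "absolutely_continuous_fun {a..b} f"
  shows "continuous_on {a..b} f"
  unfolding continuous_on_iff
proof (intro ballI allI impI)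
  fix x e :: real assume x: "x \<in> {a..b}" and "e > 0"
  obtain \<delta> where "\<delta> > 0" and \<delta>: "\<And>(m::nat) s t. (\<forall>i<m. s i \<le> t i \<and> {s i..t i} \<subseteq> {a..b}) \<Longrightarrow>
        disjoint_family_on (\<lambda>i. {s i<..<t i}) {..<m} \<Longrightarrow> (\<Sum>i<m. t i - s i) < \<delta> \<Longrightarrow>
        (\<Sum>i<m. dist (f (s i)) (f (t i))) < e"
    using assms \<open>e > 0\<close> unfolding absolutely_continuous_fun_def by meson
  show "\<exists>d>0. \<forall>x'\<in>{a..b}. dist x' x < d \<longrightarrow> dist (f x') (f x) < e"
  proof (intro exI conjI ballI impI)
    fix y assume y: "y \<in> {a..b}" "dist y x < \<delta>"
    have "dist (f (min x y)) (f (max x y)) < e"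
      using \<delta>[of 1 "\<lambda>_. min x y" "\<lambda>_. max x y"] x y
      by (auto simp: disjoint_family_on_def dist_real_def min_def max_def split: if_splits)
    then show "dist (f y) (f x) < e"
      by (auto simp: min_def max_def dist_commute split: if_splits)
  qed (rule \<open>\<delta> > 0\<close>)
qed

lemma absolutely_continuous_fun_cong:
  assumes "absolutely_continuous_fun S f" "\<And>t. t \<in> S \<Longrightarrow> g t = f t"
  shows "absolutely_continuous_fun S g"
  unfolding absolutely_continuous_fun_def
proof (intro allI impI)
  fix e :: real assume "e > 0"
  then obtain d where "d > 0" and d: "\<And>(m::nat) s t. (\<forall>i<m. s i \<le> t i \<and> {s i..t i} \<subseteq> S) \<Longrightarrow>
        disjoint_family_on (\<lambda>i. {s i<..<t i}) {..<m} \<Longrightarrow> (\<Sum>i<m. t i - s i) < d \<Longrightarrow>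
        (\<Sum>i<m. dist (f (s i)) (f (t i))) < e"
    using assms(1) unfolding absolutely_continuous_fun_def by meson
  show "\<exists>d>0. \<forall>(m::nat) s t. (\<forall>i<m. s i \<le> t i \<and> {s i..t i} \<subseteq> S) \<longrightarrow>
        disjoint_family_on (\<lambda>i. {s i<..<t i}) {..<m} \<longrightarrow> (\<Sum>i<m. t i - s i) < d \<longrightarrow>
        (\<Sum>i<m. dist (g (s i)) (g (t i))) < e"
  proof (intro exI[of _ d] conjI allI impI)
    fix m :: nat and s t
    assume st: "\<forall>i<m. s i \<le> t i \<and> {s i..t i} \<subseteq> S"
      and *: "disjoint_family_on (\<lambda>i. {s i<..<t i}) {..<m}" "(\<Sum>i<m. t i - s i) < d"
    have "(\<Sum>i<m. dist (g (s i)) (g (t i))) = (\<Sum>i<m. dist (f (s i)) (f (t i)))"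
    proof (rule sum.cong[OF refl])
      fix i assume "i \<in> {..<m}"
      then have "s i \<in> S" "t i \<in> S" using st by (force simp: subset_iff)+
      then show "dist (g (s i)) (g (t i)) = dist (f (s i)) (f (t i))" using assms(2) by simp
    qed
    then show "(\<Sum>i<m. dist (g (s i)) (g (t i))) < e" using d[OF st *] by simp
  qed (rule \<open>d > 0\<close>)
qed

lemma absolutely_continuous_fun_subset:
  assumes "absolutely_continuous_fun S f" "T \<subseteq> S"
  shows "absolutely_continuous_fun T f"
  using assms unfolding absolutely_continuous_fun_def by (meson order_trans)

section \<open>Controls and the control system\<close>

text \<open>Passage from the Bochner integral of the definitions to the gauge integral of the later
  estimates. Integrability comes from norm u \<le> 1 + (norm u)^2 on a space of finite
  measure.\<close>

lemma L2_controls_integrable: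
  assumes "u \<in> L2_controls"
  shows "u absolutely_integrable_on {0..1}"
    and "(\<lambda>t. (norm (u t))\<^sup>2) integrable_on {0..1}"
    and "(L2_norm u)\<^sup>2 = integral {0..1} (\<lambda>t. (norm (u t))\<^sup>2)"
proof -
  have m: "u \<in> borel_measurable (lebesgue_on {0..1})"
    and i: "integrable (lebesgue_on {0..1}) (\<lambda>t. (norm (u t))\<^sup>2)"
    using assms by (auto simp: L2_controls_def)
  interpret finite_measure "lebesgue_on {0..1::real}"
    by (rule finite_measure_lebesgue_on) auto
  have "integrable (lebesgue_on {0..1}) u"
  proof (rule Bochner_Integration.integrable_bound[OF Bochner_Integration.integrable_add[OF integrable_const[of 1] i] m])
    show "AE t in lebesgue_on {0..1}. norm (u t) \<le> norm (1 + (norm (u t))\<^sup>2)"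
    proof (intro AE_I2)
      fix t
      have "0 \<le> (norm (u t) - 1)\<^sup>2" by simp
      then show "norm (u t) \<le> norm (1 + (norm (u t))\<^sup>2)"
        by (simp add: power2_eq_square algebra_simps) (smt (verit) norm_ge_zero mult_nonneg_nonneg)
    qed
  qed
  then show "u absolutely_integrable_on {0..1}"
    by (subst (asm) integrable_restrict_space) (auto simp: set_integrable_def)
  show "(\<lambda>t. (norm (u t))\<^sup>2) integrable_on {0..1}"
    using i by (intro integrable_on_lebesgue_on) auto
  show "(L2_norm u)\<^sup>2 = integral {0..1} (\<lambda>t. (norm (u t))\<^sup>2)"
    using lebesgue_integral_eq_integral[OF i] integral_nonneg_AE[of "\<lambda>t. (norm (u t))\<^sup>2" "lebesgue_on {0..1}"]
    by (simp add: L2_norm_def)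
qed

text \<open>The Lipschitz hypothesis is columnwise, and \<open>A *v v\<close> combines the columns
  with coefficients bounded by norm v. This is the origin of the factor \<open>CARD('k)\<close> in
  all later constants.\<close>

lemma norm_matrix_vector_le_columns:
  fixes A :: "real ^ 'k ^ 'n"
  assumes "\<And>i. norm (column i A) \<le> B"
  shows "norm (A *v v) \<le> real CARD('k) * B * norm v"
proof -
  have "norm (A *v v) \<le> (\<Sum>i\<in>UNIV. norm ((v $ i) *s column i A))"
    unfolding matrix_mult_sum by (rule norm_sum)
  also have "\<dots> \<le> (\<Sum>i\<in>(UNIV::'k set). norm v * B)"
  proof (rule sum_mono)
    fix i
    show "norm ((v $ i) *s column i A) \<le> norm v * B"
      unfolding scalar_mult_eq_scaleR norm_scaleR
      using assms component_le_norm_cart[of v i] by (intro mult_mono) auto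
  qed
  finally show ?thesis by (simp add: mult_ac)
qed

lemma bilinear_matrix_vector_mult: "bilinear (\<lambda>(A :: real ^ 'k ^ 'n) v. A *v v)"
  by (auto simp: bilinear_def linear_iff matrix_vector_right_distrib matrix_vector_mult_add_rdistrib
      scaleR_matrix_vector_assoc matrix_vector_mult_scaleR)

section \<open>The velocity field and its bounds\<close>

locale control_system =
  fixes \<Theta> :: "'p::euclidean_space set"
    and F0 :: "real ^ 'n \<Rightarrow> 'p \<Rightarrow> real ^ 'n"
    and F :: "real ^ 'n \<Rightarrow> 'p \<Rightarrow> real ^ 'k ^ 'n"
    and x0 :: "'p \<Rightarrow> real ^ 'n"
    and L :: real
  assumes compact_param: "compact \<Theta>"
    and L_pos: "L > 0"
    and lipschitz_F0: "\<And>x1 x2 \<theta>1 \<theta>2. \<theta>1 \<in> \<Theta> \<Longrightarrow> \<theta>2 \<in> \<Theta> \<Longrightarrow>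
           norm (F0 x1 \<theta>1 - F0 x2 \<theta>2) \<le> L * (norm (x1 - x2) + norm (\<theta>1 - \<theta>2))"
    and lipschitz_F: "\<And>i x1 x2 \<theta>1 \<theta>2. \<theta>1 \<in> \<Theta> \<Longrightarrow> \<theta>2 \<in> \<Theta> \<Longrightarrow>
           norm (column i (F x1 \<theta>1) - column i (F x2 \<theta>2)) \<le> L * (norm (x1 - x2) + norm (\<theta>1 - \<theta>2))"
    and continuous_x0: "continuous_on \<Theta> x0"
begin

definition rhs :: "(real \<Rightarrow> real ^ 'k) \<Rightarrow> 'p \<Rightarrow> real \<Rightarrow> real ^ 'n \<Rightarrow> real ^ 'n" where
  "rhs u \<theta> s x = F0 x \<theta> + F x \<theta> *v u s"

text \<open>A Lipschitz constant of \<open>rhs\<close> at time s, jointly in state and parameter; it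
  becomes the Gronwall kernel.\<close>

definition modulus :: "(real \<Rightarrow> real ^ 'k) \<Rightarrow> real \<Rightarrow> real" where
  "modulus u s = L * (1 + real CARD('k) * norm (u s))"

text \<open>Twice a bound for the integral of the squared modulus over controls of norm at most r,
  hence an admissible exponent K for the weight exp (- K t), common to all such controls.\<close>

definition growth :: "real \<Rightarrow> real" where
  "growth r = 4 * L\<^sup>2 * (1 + (real CARD('k))\<^sup>2 * r\<^sup>2)"

lemma growth_pos: "growth r > 0"
  using L_pos by (simp add: growth_def add_pos_nonneg)

lemma modulus_nonneg: "modulus u s \<ge> 0"
  using L_pos by (simp add: modulus_def)

lemma norm_F_diff_mult:
  assumes "\<theta> \<in> \<Theta>" "\<theta>' \<in> \<Theta>"
  shows "norm (F x \<theta> *v v - F y \<theta>' *v v) \<le> real CARD('k) * L * (norm (x - y) + norm (\<theta> - \<theta>')) * norm v"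
proof -
  have "column i (F x \<theta> - F y \<theta>') = column i (F x \<theta>) - column i (F y \<theta>')" for i
    by (simp add: column_def vec_eq_iff)
  then have "norm ((F x \<theta> - F y \<theta>') *v v) \<le> real CARD('k) * (L * (norm (x - y) + norm (\<theta> - \<theta>'))) * norm v"
    using lipschitz_F assms by (intro norm_matrix_vector_le_columns) simp
  then show ?thesis by (simp add: matrix_vector_mult_diff_rdistrib mult_ac)
qed

lemma norm_rhs_diff:
  assumes "\<theta> \<in> \<Theta>" "\<theta>' \<in> \<Theta>"
  shows "norm (rhs u \<theta> s x - rhs u \<theta>' s y) \<le> modulus u s * (norm (x - y) + norm (\<theta> - \<theta>'))"
proof -
  have "rhs u \<theta> s x - rhs u \<theta>' s y = (F0 x \<theta> - F0 y \<theta>') + (F x \<theta> *v u s - F y \<theta>' *v u s)"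
    by (simp add: rhs_def)
  also have "norm \<dots> \<le> L * (norm (x - y) + norm (\<theta> - \<theta>')) +
      real CARD('k) * L * (norm (x - y) + norm (\<theta> - \<theta>')) * norm (u s)"
    using lipschitz_F0 norm_F_diff_mult assms by (intro order_trans[OF norm_triangle_ineq add_mono]) auto
  finally show ?thesis by (simp add: modulus_def algebra_simps)
qed

lemma modulus_integrable:
  assumes "u \<in> L2_controls"
  shows "modulus u absolutely_integrable_on {0..1}"
    and "(\<lambda>s. (modulus u s)\<^sup>2) integrable_on {0..1}"
    and "L2_norm u \<le> r \<Longrightarrow> integral {0..1} (\<lambda>s. (modulus u s)\<^sup>2) \<le> growth r / 2"
proof -
  note u = L2_controls_integrable[OF assms]
  have nu: "(\<lambda>s. norm (u s)) absolutely_integrable_on {0..1}"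
    using absolutely_integrable_norm[OF u(1)] by (simp add: o_def)
  show "modulus u absolutely_integrable_on {0..1}"
    unfolding modulus_def using nu
    by (intro set_integrable_mult_right set_integral_add(1)) auto
  have expand: "(modulus u s)\<^sup>2 = L\<^sup>2 + 2 * L\<^sup>2 * real CARD('k) * norm (u s) + L\<^sup>2 * (real CARD('k))\<^sup>2 * (norm (u s))\<^sup>2" for s
    by (simp add: modulus_def power2_eq_square algebra_simps)
  show i: "(\<lambda>s. (modulus u s)\<^sup>2) integrable_on {0..1}"
    unfolding expand using u(2) nu
    by (intro integrable_add integrable_on_mult_right) (auto intro: set_lebesgue_integral_eq_integral(1))
  have "(modulus u s)\<^sup>2 \<le> 2 * L\<^sup>2 + 2 * L\<^sup>2 * (real CARD('k))\<^sup>2 * (norm (u s))\<^sup>2" for s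
  proof -
    \<comment> \<open>This is (1 + q)^2 \<le> 2 + 2 q^2 with q = \<open>CARD('k)\<close> * norm (u
      s), up to the factor L^2; it removes the term linear in norm (u s), so that only the L2 norm
      remains.\<close>
    have "0 \<le> (L * (real CARD('k) * norm (u s) - 1))\<^sup>2" by simp
    then show ?thesis unfolding expand by (simp add: power2_eq_square algebra_simps)
  qed
  then have "integral {0..1} (\<lambda>s. (modulus u s)\<^sup>2) \<le>
      integral {0..1} (\<lambda>s. 2 * L\<^sup>2 + 2 * L\<^sup>2 * (real CARD('k))\<^sup>2 * (norm (u s))\<^sup>2)"
    using i u(2) by (intro integral_le integrable_add integrable_on_mult_right) auto
  also have "\<dots> = 2 * L\<^sup>2 + 2 * L\<^sup>2 * (real CARD('k))\<^sup>2 * (L2_norm u)\<^sup>2"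
    using u(2,3) by (subst Henstock_Kurzweil_Integration.integral_add) (auto intro!: integrable_on_mult_right)
  finally have le: "integral {0..1} (\<lambda>s. (modulus u s)\<^sup>2) \<le> 2 * L\<^sup>2 + 2 * L\<^sup>2 * (real CARD('k))\<^sup>2 * (L2_norm u)\<^sup>2" .
  assume "L2_norm u \<le> r"
  then have "(L2_norm u)\<^sup>2 \<le> r\<^sup>2"
    by (intro power_mono) (auto simp: L2_norm_def)
  then have "2 * L\<^sup>2 * (real CARD('k))\<^sup>2 * (L2_norm u)\<^sup>2 \<le> 2 * L\<^sup>2 * (real CARD('k))\<^sup>2 * r\<^sup>2"
    by (intro mult_left_mono) auto
  then show "integral {0..1} (\<lambda>s. (modulus u s)\<^sup>2) \<le> growth r / 2"
    using le by (simp add: growth_def algebra_simps)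
qed

lemma continuous_F0: "continuous_on (UNIV \<times> \<Theta>) (\<lambda>(x, \<theta>). F0 x \<theta>)"
  and continuous_F: "continuous_on (UNIV \<times> \<Theta>) (\<lambda>(x, \<theta>). F x \<theta>)"
proof -
  have lip: "continuous_on (UNIV \<times> \<Theta>) (\<lambda>(x, \<theta>). h x \<theta>)"
    if h: "\<And>x1 x2 \<theta>1 \<theta>2. \<theta>1 \<in> \<Theta> \<Longrightarrow> \<theta>2 \<in> \<Theta> \<Longrightarrow>
           norm (h x1 \<theta>1 - h x2 \<theta>2) \<le> L * (norm (x1 - x2) + norm (\<theta>1 - \<theta>2))"
    for h :: "real ^ 'n \<Rightarrow> 'p \<Rightarrow> real ^ 'n"
  proof (rule lipschitz_on_continuous_on, rule lipschitz_onI)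
    fix p q assume pq: "p \<in> (UNIV :: (real ^ 'n) set) \<times> \<Theta>" "q \<in> (UNIV :: (real ^ 'n) set) \<times> \<Theta>"
    have "dist (case p of (x, \<theta>) \<Rightarrow> h x \<theta>) (case q of (x, \<theta>) \<Rightarrow> h x \<theta>)
        \<le> L * (norm (fst p - fst q) + norm (snd p - snd q))"
      using h[of "snd p" "snd q"] pq by (auto simp: dist_norm case_prod_unfold)
    also have "\<dots> \<le> L * (dist p q + dist p q)"
      using L_pos dist_fst_le[of p q] dist_snd_le[of p q]
      by (intro mult_left_mono add_mono) (auto simp: dist_norm)
    finally show "dist (case p of (x, \<theta>) \<Rightarrow> h x \<theta>) (case q of (x, \<theta>) \<Rightarrow> h x \<theta>) \<le> (2 * L) * dist p q"
      by (simp add: algebra_simps)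
  qed (use L_pos in simp)
  show "continuous_on (UNIV \<times> \<Theta>) (\<lambda>(x, \<theta>). F0 x \<theta>)"
    by (rule lip) (rule lipschitz_F0)
  have col: "continuous_on (UNIV \<times> \<Theta>) (\<lambda>(x, \<theta>). column j (F x \<theta>))" for j
    by (rule lip) (rule lipschitz_F)
  have "(\<lambda>(x, \<theta>). F x \<theta>) = (\<lambda>p. \<chi> i j. (case p of (x, \<theta>) \<Rightarrow> column j (F x \<theta>)) $ i)"
    by (auto simp: fun_eq_iff vec_eq_iff column_def)
  then show "continuous_on (UNIV \<times> \<Theta>) (\<lambda>(x, \<theta>). F x \<theta>)"
    by (simp only:) (intro continuous_on_vec_lambda continuous_on_component col)
qed

lemma continuous_along:
  assumes "continuous_on {a..b} x" "\<theta> \<in> \<Theta>"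
  shows "continuous_on {a..b} (\<lambda>s. F0 (x s) \<theta>)" "continuous_on {a..b} (\<lambda>s. F (x s) \<theta>)"
proof -
  have "continuous_on {a..b} (\<lambda>s. (x s, \<theta>))" "(\<lambda>s. (x s, \<theta>)) ` {a..b} \<subseteq> UNIV \<times> \<Theta>"
    using assms by (auto intro!: continuous_intros)
  from continuous_on_compose2[OF continuous_F0 this] continuous_on_compose2[OF continuous_F this]
  show "continuous_on {a..b} (\<lambda>s. F0 (x s) \<theta>)" "continuous_on {a..b} (\<lambda>s. F (x s) \<theta>)"
    by simp_all
qed

lemma F_mult_absolutely_integrable:
  fixes a b :: real
  assumes "continuous_on {a..b} x" "\<theta> \<in> \<Theta>" "u absolutely_integrable_on {a..b}"
  shows "(\<lambda>s. F (x s) \<theta> *v u s) absolutely_integrable_on {a..b}"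
proof (rule absolutely_integrable_bounded_measurable_product[OF bilinear_matrix_vector_mult])
  note c = continuous_along(2)[OF assms(1,2)]
  show "(\<lambda>s. F (x s) \<theta>) \<in> borel_measurable (lebesgue_on {a..b})"
    using c by (rule continuous_imp_measurable_on_sets_lebesgue) auto
  show "bounded ((\<lambda>s. F (x s) \<theta>) ` {a..b})"
    using c compact_continuous_image compact_imp_bounded by blast
  show "{a..b} \<in> sets lebesgue" by simp
qed (use assms in auto)

lemma rhs_absolutely_integrable:
  assumes "continuous_on {0..1} x" "\<theta> \<in> \<Theta>" "u \<in> L2_controls"
  shows "(\<lambda>s. rhs u \<theta> s (x s)) absolutely_integrable_on {0..1}"
  unfolding rhs_def
  using F_mult_absolutely_integrable[OF assms(1,2) L2_controls_integrable(1)[OF assms(3)]]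
    continuous_along(1)[OF assms(1,2)] absolutely_integrable_continuous_real
  by (intro set_integral_add(1)) auto

lemma rhs_integrable:
  assumes "continuous_on {0..1} x" "\<theta> \<in> \<Theta>" "u \<in> L2_controls" "{a..b} \<subseteq> {0..1}"
  shows "(\<lambda>s. rhs u \<theta> s (x s)) integrable_on {a..b}"
  using rhs_absolutely_integrable[OF assms(1-3)] assms(4)
  by (meson set_lebesgue_integral_eq_integral(1) absolutely_integrable_on_subinterval)

lemma F_bound:
  obtains M where "M > 0"
    "\<And>y p. norm y \<le> R \<Longrightarrow> p \<in> \<Theta> \<Longrightarrow> norm (F0 y p) \<le> M"
    "\<And>y p v. norm y \<le> R \<Longrightarrow> p \<in> \<Theta> \<Longrightarrow> norm (F y p *v v) \<le> M * norm v"
proof -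
  have cpt: "compact (cball (0::real ^ 'n) R \<times> \<Theta>)"
    by (intro compact_Times compact_cball compact_param)
  have "bounded ((\<lambda>(y, p). F0 y p) ` (cball 0 R \<times> \<Theta>))"
    by (intro compact_imp_bounded compact_continuous_image cpt continuous_on_subset[OF continuous_F0]) auto
  then obtain M0 where M0: "\<And>y p. norm y \<le> R \<Longrightarrow> p \<in> \<Theta> \<Longrightarrow> norm (F0 y p) \<le> M0"
    by (force simp: bounded_iff)
  have "bounded ((\<lambda>(y, p). F y p) ` (cball 0 R \<times> \<Theta>))"
    by (intro compact_imp_bounded compact_continuous_image cpt continuous_on_subset[OF continuous_F]) auto
  then obtain M1 where M1: "\<And>y p. norm y \<le> R \<Longrightarrow> p \<in> \<Theta> \<Longrightarrow> norm (F y p) \<le> M1"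
    by (force simp: bounded_iff)
  obtain B where "B > 0" and B: "\<And>(A :: real ^ 'k ^ 'n) v. norm (A *v v) \<le> B * norm A * norm v"
    using bilinear_bounded_pos[OF bilinear_matrix_vector_mult] by blast
  show ?thesis
  proof (rule that[of "\<bar>M0\<bar> + B * \<bar>M1\<bar> + 1"])
    show "\<bar>M0\<bar> + B * \<bar>M1\<bar> + 1 > 0" using \<open>B > 0\<close> by (simp add: add_nonneg_pos)
    fix y :: "real ^ 'n" and p assume yp: "norm y \<le> R" "p \<in> \<Theta>"
    have "0 \<le> B * \<bar>M1\<bar>" using \<open>B > 0\<close> by simp
    then show "norm (F0 y p) \<le> \<bar>M0\<bar> + B * \<bar>M1\<bar> + 1" using M0[OF yp] by linarith
    fix v :: "real ^ 'k"
    have "B * norm (F y p) \<le> B * \<bar>M1\<bar>" using M1[OF yp] \<open>B > 0\<close> by (intro mult_left_mono) auto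
    then have "B * norm (F y p) * norm v \<le> (\<bar>M0\<bar> + B * \<bar>M1\<bar> + 1) * norm v"
      by (intro mult_right_mono) auto
    then show "norm (F y p *v v) \<le> (\<bar>M0\<bar> + B * \<bar>M1\<bar> + 1) * norm v"
      using B[of "F y p" v] by linarith
  qed
qed

text \<open>Along a path inside a ball the velocity is dominated by a multiple of the modulus, whose
  square is integrable: the majorant that \<open>absolutely_continuous_integral\<close> asks for.
  Division by L compensates for the factor L inside \<open>modulus\<close>.\<close>

lemma rhs_bound:
  obtains M where "M > 0"
    "\<And>y p u s. norm y \<le> R \<Longrightarrow> p \<in> \<Theta> \<Longrightarrow> norm (rhs u p s y) \<le> M * modulus u s"
proof -
  obtain M where "M > 0" and M: "\<And>y p. norm y \<le> R \<Longrightarrow> p \<in> \<Theta> \<Longrightarrow> norm (F0 y p) \<le> M"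
    "\<And>y p v. norm y \<le> R \<Longrightarrow> p \<in> \<Theta> \<Longrightarrow> norm (F y p *v v) \<le> M * norm v"
    using F_bound[of R] by metis
  show ?thesis
  proof (rule that[of "M / L"])
    show "M / L > 0" using \<open>M > 0\<close> L_pos by simp
    fix y :: "real ^ 'n" and p u s assume yp: "norm y \<le> R" "p \<in> \<Theta>"
    have "norm (rhs u p s y) \<le> M + M * norm (u s)"
      unfolding rhs_def using M[OF yp] by (intro order_trans[OF norm_triangle_ineq add_mono]) auto
    also have "norm (u s) \<le> real CARD('k) * norm (u s)"
      using mult_right_mono[of 1 "real CARD('k)" "norm (u s)"] by simp
    finally show "norm (rhs u p s y) \<le> M / L * modulus u s"
      using \<open>M > 0\<close> L_pos by (simp add: modulus_def algebra_simps)
  qed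
qed

section \<open>Solutions as solutions of the integral equation\<close>

text \<open>In this form plain continuity is enough to ask for, since the integral itself supplies
  absolute continuity; contraction and Gronwall arguments apply directly.\<close>

definition integral_solution :: "(real \<Rightarrow> real ^ 'k) \<Rightarrow> 'p \<Rightarrow> (real \<Rightarrow> real ^ 'n) \<Rightarrow> bool" where
  "integral_solution u \<theta> x \<longleftrightarrow> continuous_on {0..1} x \<and>
     (\<forall>t\<in>{0..1}. x t = x0 \<theta> + integral {0..t} (\<lambda>s. rhs u \<theta> s (x s)))"

lemma is_solution_imp_integral_solution:
  assumes "\<theta> \<in> \<Theta>" "u \<in> L2_controls" "is_solution F0 F x0 u \<theta> x"
  shows "integral_solution u \<theta> x"
  unfolding integral_solution_def
proof (intro conjI ballI)
  have ac: "absolutely_continuous_fun {0..1} x" and x0: "x 0 = x0 \<theta>"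
    and ae: "AE t in lebesgue_on {0..1}. (x has_vector_derivative rhs u \<theta> t (x t)) (at t within {0..1})"
    using assms(3) by (auto simp: is_solution_def rhs_def)
  show "continuous_on {0..1} x"
    using ac by (rule absolutely_continuous_fun_imp_continuous_on)
  have "AE t in lebesgue. t \<in> {0..1} \<longrightarrow> (x has_vector_derivative rhs u \<theta> t (x t)) (at t within {0..1})"
    using ae by (subst (asm) AE_restrict_space_iff) auto
  then obtain E where E: "E \<in> null_sets lebesgue"
     "{t. \<not> (t \<in> {0..1} \<longrightarrow> (x has_vector_derivative rhs u \<theta> t (x t)) (at t within {0..1}))} \<subseteq> E"
    by (auto simp: eventually_ae_filter)
  fix t :: real assume t: "t \<in> {0..1}"
  have "((\<lambda>s. rhs u \<theta> s (x s)) has_integral (x t - x 0)) {0..t}"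
  proof (rule absolutely_continuous_has_integral)
    show "absolutely_continuous_fun {0..t} x"
      using ac t by (auto intro: absolutely_continuous_fun_subset)
    show "negligible E" using E by (simp add: negligible_iff_null_sets)
    fix s assume "s \<in> {0..t} - E"
    then have "s \<in> {0..1}" "s \<notin> E" using t by auto
    then have "(x has_vector_derivative rhs u \<theta> s (x s)) (at s within {0..1})"
      using E(2) by blast
    then show "(x has_vector_derivative rhs u \<theta> s (x s)) (at s within {0..t})"
      by (rule has_vector_derivative_within_subset) (use t in auto)
  qed (use t in auto)
  then show "x t = x0 \<theta> + integral {0..t} (\<lambda>s. rhs u \<theta> s (x s))"
    using x0 by (simp add: integral_unique)
qed

lemma integral_solution_imp_is_solution:
  assumes "\<theta> \<in> \<Theta>" "u \<in> L2_controls" and sol: "integral_solution u \<theta> x"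
  shows "is_solution F0 F x0 u \<theta> x"
proof -
  define h where "h s = rhs u \<theta> s (x s)" for s
  have cont: "continuous_on {0..1} x"
    and x: "\<And>t. t \<in> {0..1} \<Longrightarrow> x t = x0 \<theta> + integral {0..t} h"
    using sol by (auto simp: integral_solution_def h_def[abs_def])
  have h: "h integrable_on {0..1}"
    using rhs_integrable[OF cont assms(1,2), of 0 1] by (simp add: h_def[abs_def])
  obtain R where "\<And>s. s \<in> {0..1} \<Longrightarrow> norm (x s) \<le> R"
    using compact_imp_bounded[OF compact_continuous_image[OF cont compact_Icc]] unfolding bounded_iff by blast
  moreover obtain M where "M > 0" and M: "\<And>y p u s. norm y \<le> R \<Longrightarrow> p \<in> \<Theta> \<Longrightarrow> norm (rhs u p s y) \<le> M * modulus u s"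
    using rhs_bound by metis
  ultimately have hM: "norm (h s) \<le> M * modulus u s" if "s \<in> {0..1}" for s
    using that assms(1) by (simp add: h_def)
  have ac: "absolutely_continuous_fun {0..1} (\<lambda>t. x0 \<theta> + integral {0..t} h)"
  proof (rule absolutely_continuous_integral[OF h])
    show "(\<lambda>s. M * modulus u s) integrable_on {0..1}"
      by (intro integrable_on_mult_right set_lebesgue_integral_eq_integral(1) modulus_integrable assms)
    show "(\<lambda>s. (M * modulus u s)\<^sup>2) integrable_on {0..1}"
      unfolding power_mult_distrib by (intro integrable_on_mult_right modulus_integrable assms)
  qed (rule hM)
  show ?thesis
    unfolding is_solution_def
  proof (intro conjI)
    show "absolutely_continuous_fun {0..1} x"
      using ac by (rule absolutely_continuous_fun_cong) (use x in auto)
    let ?E = "{t \<in> {0..1}. \<not> ((\<lambda>u. integral {0..u} h) has_vector_derivative h t) (at t within {0..1})}"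
    have "?E \<in> null_sets lebesgue"
      using negligible_not_has_vector_derivative_integral[OF h] by (simp add: negligible_iff_null_sets)
    then have "AE t in lebesgue. t \<in> {0..1} \<longrightarrow> (x has_vector_derivative h t) (at t within {0..1})"
    proof (rule AE_I')
      show "{t \<in> space lebesgue. \<not> (t \<in> {0..1} \<longrightarrow> (x has_vector_derivative h t) (at t within {0..1}))} \<subseteq> ?E"
      proof (intro subsetI, rule ccontr)
        fix t assume t: "t \<in> {t \<in> space lebesgue. \<not> (t \<in> {0..1} \<longrightarrow> (x has_vector_derivative h t) (at t within {0..1}))}"
          and "t \<notin> ?E"
        then have "((\<lambda>u. integral {0..u} h) has_vector_derivative h t) (at t within {0..1})" by blast
        then have "((\<lambda>u. x0 \<theta> + integral {0..u} h) has_vector_derivative h t) (at t within {0..1})"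
          by (auto intro!: derivative_eq_intros)
        then have "(x has_vector_derivative h t) (at t within {0..1})"
          using t x by (intro has_vector_derivative_transform[of t "{0..1}" x]) auto
        then show False using t by simp
      qed
    qed
    then show "AE t in lebesgue_on {0..1}. (x has_vector_derivative F0 (x t) \<theta> + F (x t) \<theta> *v u t) (at t within {0..1})"
      by (subst AE_restrict_space_iff) (auto simp: h_def rhs_def)
    show "x 0 = x0 \<theta>" using x[of 0] by simp
  qed
qed

text \<open>Picard's contraction with the weight built into the unknown: y stands for exp (- K s)
  times the trajectory, so the plain sup metric on y is the weighted one, the contraction factor is
  1/2, and all of [0,1] is treated in one step.\<close>

lemma ex_integral_solution:
  assumes "\<theta> \<in> \<Theta>" "u \<in> L2_controls"
  shows "\<exists>x. integral_solution u \<theta> x"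
proof -
  note c = modulus_integrable(1,2)[OF assms(2)]
  define K where "K = growth (L2_norm u)"
  have K: "K > 0" "integral {0..1} (\<lambda>s. (modulus u s)\<^sup>2) \<le> K / 2"
    using growth_pos modulus_integrable(3)[OF assms(2)] by (auto simp: K_def)
  \<comment> \<open>X y removes the weight from y; P below applies the integral operator and puts
    the weight back.\<close>
  define X where "X y s = exp (K * s) *\<^sub>R apply_bcontfun y s" for y :: "real \<Rightarrow>\<^sub>C (real ^ 'n)" and s
  have X: "continuous_on {0..1} (X y)" for y
    unfolding X_def[abs_def] by (intro continuous_intros continuous_on_apply_bcontfun)
  define P where "P y t = exp (- K * t) *\<^sub>R (x0 \<theta> + integral {0..t} (\<lambda>s. rhs u \<theta> s (X y s)))" for y t
  have contP: "continuous_on {0..1} (P y)" for y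
    unfolding P_def[abs_def]
    by (intro continuous_intros indefinite_integral_continuous_1 rhs_integrable[OF X assms]) auto
  \<comment> \<open>The complete space of bounded continuous functions lives on the whole line;
    clamping time to [0,1] puts P y into it without altering its values on [0,1].\<close>
  define \<tau> where "\<tau> t = max 0 (min 1 t)" for t :: real
  have \<tau>: "\<tau> t \<in> {0..1}" and \<tau>_id: "t \<in> {0..1} \<Longrightarrow> \<tau> t = t" for t by (auto simp: \<tau>_def)
  have "(\<lambda>t. P y (\<tau> t)) \<in> bcontfun" for y
    unfolding bcontfun_def
  proof (intro CollectI conjI)
    show "continuous_on UNIV (\<lambda>t. P y (\<tau> t))"
      by (rule continuous_on_compose2[OF contP]) (use \<tau> in \<open>auto simp: \<tau>_def[abs_def] intro!: continuous_intros\<close>)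
    show "bounded (range (\<lambda>t. P y (\<tau> t)))"
      using compact_imp_bounded[OF compact_continuous_image[OF contP compact_Icc]]
      by (rule bounded_subset) (use \<tau> in blast)
  qed
  define S where "S y = Bcontfun (\<lambda>t. P y (\<tau> t))" for y
  have S: "apply_bcontfun (S y) t = P y (\<tau> t)" for y t
    using \<open>(\<lambda>t. P y (\<tau> t)) \<in> bcontfun\<close> by (simp add: S_def Bcontfun_inverse)
  have "dist (S y) (S y') \<le> 1/2 * dist y y'" for y y'
  proof (rule dist_bound)
    fix r
    define t where "t = \<tau> r"
    have t: "t \<in> {0..1}" using \<tau> by (simp add: t_def)
    have int: "(\<lambda>s. rhs u \<theta> s (X y s)) integrable_on {0..t}" for y
      using t by (intro rhs_integrable[OF X assms]) auto
    have "norm (integral {0..t} (\<lambda>s. rhs u \<theta> s (X y s)) - integral {0..t} (\<lambda>s. rhs u \<theta> s (X y' s)))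
       = norm (integral {0..t} (\<lambda>s. rhs u \<theta> s (X y s) - rhs u \<theta> s (X y' s)))"
      using int by (simp add: Henstock_Kurzweil_Integration.integral_diff)
    also have "\<dots> \<le> integral {0..t} (\<lambda>s. dist y y' * (modulus u s * exp (K * s)))"
    proof (rule Henstock_Kurzweil_Integration.integral_norm_bound_integral)
      show "(\<lambda>s. rhs u \<theta> s (X y s) - rhs u \<theta> s (X y' s)) integrable_on {0..t}"
        by (intro integrable_diff int)
      show "(\<lambda>s. dist y y' * (modulus u s * exp (K * s))) integrable_on {0..t}"
      proof (intro integrable_on_mult_right set_lebesgue_integral_eq_integral(1) continuous_times_absolutely_integrable)
        show "modulus u absolutely_integrable_on {0..t}"
          using c(1) by (rule absolutely_integrable_on_subinterval) (use t in auto)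
      qed (intro continuous_intros)
      fix s
      have "norm (rhs u \<theta> s (X y s) - rhs u \<theta> s (X y' s)) \<le> modulus u s * norm (X y s - X y' s)"
        using norm_rhs_diff[OF assms(1,1)] by simp
      also have "\<dots> \<le> modulus u s * (exp (K * s) * dist y y')"
      proof (rule mult_left_mono[OF _ modulus_nonneg])
        have "norm (X y s - X y' s) = exp (K * s) * dist (apply_bcontfun y s) (apply_bcontfun y' s)"
          by (simp add: X_def dist_norm flip: scaleR_diff_right)
        also have "\<dots> \<le> exp (K * s) * dist y y'"
          by (intro mult_left_mono dist_bounded) auto
        finally show "norm (X y s - X y' s) \<le> exp (K * s) * dist y y'" .
      qed
      finally show "norm (rhs u \<theta> s (X y s) - rhs u \<theta> s (X y' s)) \<le> dist y y' * (modulus u s * exp (K * s))"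
        by (simp add: mult_ac)
    qed
    also have "\<dots> = dist y y' * integral {0..t} (\<lambda>s. modulus u s * exp (K * s))" by simp
    also have "\<dots> \<le> dist y y' * (exp (K * t) / 2)"
      by (intro mult_left_mono integral_exp_weight_le c K t) auto
    finally have "norm (integral {0..t} (\<lambda>s. rhs u \<theta> s (X y s)) - integral {0..t} (\<lambda>s. rhs u \<theta> s (X y' s)))
        \<le> dist y y' * (exp (K * t) / 2)" .
    then have "exp (- K * t) * norm (integral {0..t} (\<lambda>s. rhs u \<theta> s (X y s)) - integral {0..t} (\<lambda>s. rhs u \<theta> s (X y' s)))
        \<le> exp (- K * t) * (dist y y' * (exp (K * t) / 2))"
      by (intro mult_left_mono) auto
    also have "\<dots> = 1/2 * dist y y'" by (simp add: exp_minus field_simps)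
    finally show "dist (apply_bcontfun (S y) r) (apply_bcontfun (S y') r) \<le> 1/2 * dist y y'"
      by (simp add: S P_def dist_norm t_def flip: scaleR_diff_right)
  qed
  then obtain y where "S y = y"
    using banach_fix_type[of "1/2" S] by auto
  then have y: "apply_bcontfun y t = P y t" if "t \<in> {0..1}" for t
    using S[of y t] \<tau>_id[OF that] by simp
  have "X y t = x0 \<theta> + integral {0..t} (\<lambda>s. rhs u \<theta> s (X y s))" if "t \<in> {0..1}" for t
  proof -
    have "X y t = exp (K * t) *\<^sub>R P y t" using y[OF that] by (simp add: X_def)
    then show ?thesis by (simp add: P_def exp_minus)
  qed
  then have "integral_solution u \<theta> (X y)"
    using X by (simp add: integral_solution_def)
  then show ?thesis by blast
qed

text \<open>The factor depends on the control through r alone, so one constant serves a whole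
  norm-bounded sequence.\<close>

lemma norm_diff_le_of_modulus:
  assumes u: "u \<in> L2_controls" "L2_norm u \<le> r"
    and cont: "continuous_on {0..1} x" "continuous_on {0..1} y"
    and le: "\<And>t. t \<in> {0..1} \<Longrightarrow> norm (x t - y t) \<le> A + integral {0..t} (\<lambda>s. modulus u s * norm (x s - y s))"
    and t: "t \<in> {0..1}"
  shows "norm (x t - y t) \<le> 2 * A * exp (growth r)"
  using le by (intro gronwall_L2[of "modulus u" "growth r" "\<lambda>t. norm (x t - y t)"] modulus_integrable u growth_pos
      modulus_nonneg t) (auto intro!: continuous_intros cont)

text \<open>Changes of the initial value and of the parameter inside the velocity act as the
  constant A of Gronwall's inequality. Equal parameters give uniqueness, varying ones give
  continuity in the parameter, uniformly in time.\<close>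

lemma integral_solution_stability:
  assumes sol: "integral_solution u \<theta> x" "integral_solution u \<theta>' y" and \<theta>: "\<theta> \<in> \<Theta>" "\<theta>' \<in> \<Theta>"
    and u: "u \<in> L2_controls" "L2_norm u \<le> r" and t: "t \<in> {0..1}"
  shows "norm (x t - y t) \<le> 2 * (norm (x0 \<theta> - x0 \<theta>') + integral {0..1} (modulus u) * norm (\<theta> - \<theta>')) * exp (growth r)"
proof (rule norm_diff_le_of_modulus[OF u _ _ _ t])
  show cont: "continuous_on {0..1} x" "continuous_on {0..1} y"
    using sol by (auto simp: integral_solution_def)
  fix t :: real assume t: "t \<in> {0..1}"
  have sub: "{0..t} \<subseteq> {0..1}" using t by auto
  have m1: "modulus u absolutely_integrable_on {0..t}"
    using modulus_integrable(1)[OF u(1)] sub by (rule absolutely_integrable_on_subinterval)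
  have m: "modulus u integrable_on {0..t}"
    using m1 by (rule set_lebesgue_integral_eq_integral(1))
  have mx: "(\<lambda>s. modulus u s * norm (x s - y s)) integrable_on {0..t}"
    using m1 cont sub by (intro set_lebesgue_integral_eq_integral(1) continuous_times_absolutely_integrable)
      (auto intro!: continuous_intros intro: continuous_on_subset)
  have ix: "(\<lambda>s. rhs u \<theta> s (x s)) integrable_on {0..t}" and iy: "(\<lambda>s. rhs u \<theta>' s (y s)) integrable_on {0..t}"
    using rhs_integrable cont \<theta> u sub by auto
  have "x t - y t = (x0 \<theta> - x0 \<theta>') + integral {0..t} (\<lambda>s. rhs u \<theta> s (x s) - rhs u \<theta>' s (y s))"
    using sol t ix iy by (simp add: integral_solution_def Henstock_Kurzweil_Integration.integral_diff)
  also have "norm \<dots> \<le> norm (x0 \<theta> - x0 \<theta>') + norm (integral {0..t} (\<lambda>s. rhs u \<theta> s (x s) - rhs u \<theta>' s (y s)))"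
    by (rule norm_triangle_ineq)
  also have "norm (integral {0..t} (\<lambda>s. rhs u \<theta> s (x s) - rhs u \<theta>' s (y s)))
      \<le> integral {0..t} (\<lambda>s. modulus u s * norm (x s - y s) + modulus u s * norm (\<theta> - \<theta>'))"
    using norm_rhs_diff[OF \<theta>, of u] unfolding distrib_left
    by (intro Henstock_Kurzweil_Integration.integral_norm_bound_integral integrable_diff integrable_add
      integrable_on_mult_left ix iy m mx)
  also have "\<dots> = integral {0..t} (\<lambda>s. modulus u s * norm (x s - y s)) + integral {0..t} (modulus u) * norm (\<theta> - \<theta>')"
    using m mx by (subst Henstock_Kurzweil_Integration.integral_add) (auto intro: integrable_on_mult_left)
  \<comment> \<open>Gronwall needs A independent of t, hence the enlargement to the full
    interval.\<close>
  also have "integral {0..t} (modulus u) * norm (\<theta> - \<theta>') \<le> integral {0..1} (modulus u) * norm (\<theta> - \<theta>')"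
    using m sub modulus_nonneg set_lebesgue_integral_eq_integral(1)[OF modulus_integrable(1)[OF u(1)]]
    by (intro mult_right_mono integral_subset_le) auto
  finally show "norm (x t - y t) \<le> norm (x0 \<theta> - x0 \<theta>') + integral {0..1} (modulus u) * norm (\<theta> - \<theta>') +
      integral {0..t} (\<lambda>s. modulus u s * norm (x s - y s))" by simp
qed

lemma integral_solution_unique:
  assumes "integral_solution u \<theta> x" "integral_solution u \<theta> y" "\<theta> \<in> \<Theta>" "u \<in> L2_controls" "t \<in> {0..1}"
  shows "x t = y t"
  using integral_solution_stability[OF assms(1,2,3,3,4) order_refl assms(5)] by simp

text \<open>Resolves the definite description: restricting a solution makes it extensional, and
  uniqueness on [0,1] then makes it unique as a function. From here on trajectories are known
  through their integral equation.\<close>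

lemma integral_solution_trajectory:
  assumes "\<theta> \<in> \<Theta>" "u \<in> L2_controls"
  shows "integral_solution u \<theta> (trajectory F0 F x0 u \<theta>)"
proof -
  have iff: "is_solution F0 F x0 u \<theta> x \<longleftrightarrow> integral_solution u \<theta> x" for x
    using is_solution_imp_integral_solution integral_solution_imp_is_solution assms by blast
  obtain x where x: "integral_solution u \<theta> x" using ex_integral_solution[OF assms] by blast
  have "integral_solution u \<theta> (restrict x {0..1})"
    unfolding integral_solution_def
  proof (intro conjI ballI)
    show "continuous_on {0..1} (restrict x {0..1})"
      using x continuous_on_cong[of "{0..1}" "{0..1}" "restrict x {0..1}" x] by (simp add: integral_solution_def)
    fix t :: real assume t: "t \<in> {0..1}"
    have "integral {0..t} (\<lambda>s. rhs u \<theta> s (restrict x {0..1} s)) = integral {0..t} (\<lambda>s. rhs u \<theta> s (x s))"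
      by (rule Henstock_Kurzweil_Integration.integral_cong) (use t in auto)
    then show "restrict x {0..1} t = x0 \<theta> + integral {0..t} (\<lambda>s. rhs u \<theta> s (restrict x {0..1} s))"
      using x t by (simp add: integral_solution_def)
  qed
  then have "\<exists>!x. x \<in> extensional {0..1} \<and> integral_solution u \<theta> x"
    using integral_solution_unique[OF _ _ assms]
    by (intro ex_ex1I) (blast, blast intro: extensionalityI)
  then show ?thesis
    unfolding trajectory_def iff by (rule theI'[THEN conjunct2])
qed

end

section \<open>Weak continuity of the control-to-trajectory map\<close>

text \<open>Finitely many balls cover S on each of which every r n varies by less than e / 2; at
  their centres pointwise convergence is simultaneous.\<close>

lemma pointwise_limit_equicontinuous_imp_uniform:
  fixes r :: "nat \<Rightarrow> 'a::metric_space \<Rightarrow> 'b::real_normed_vector"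
  assumes "compact S"
    and equi: "\<And>p e. p \<in> S \<Longrightarrow> e > 0 \<Longrightarrow> \<exists>d>0. \<forall>q\<in>S. dist q p < d \<longrightarrow> (\<forall>n. norm (r n q - r n p) < e)"
    and lim: "\<And>p. p \<in> S \<Longrightarrow> (\<lambda>n. r n p) \<longlonglongrightarrow> 0"
    and "e > 0"
  shows "\<forall>\<^sub>F n in sequentially. \<forall>p\<in>S. norm (r n p) < e"
proof -
  have "\<forall>p\<in>S. \<exists>d>0. \<forall>q\<in>S. dist q p < d \<longrightarrow> (\<forall>n. norm (r n q - r n p) < e / 2)"
    using equi[of _ "e / 2"] \<open>e > 0\<close> by simp
  then obtain d where d: "\<And>p. p \<in> S \<Longrightarrow> d p > 0"
    "\<And>p q n. p \<in> S \<Longrightarrow> q \<in> S \<Longrightarrow> dist q p < d p \<Longrightarrow> norm (r n q - r n p) < e / 2"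
    by metis
  obtain C where C: "C \<subseteq> S" "finite C" "S \<subseteq> (\<Union>p\<in>C. ball p (d p))"
  proof (rule compactE_image[OF \<open>compact S\<close>, of S "\<lambda>p. ball p (d p)"])
    show "S \<subseteq> (\<Union>p\<in>S. ball p (d p))"
    proof
      fix p assume "p \<in> S"
      then show "p \<in> (\<Union>p\<in>S. ball p (d p))" using d(1)[of p] by (intro UN_I[of p]) simp_all
    qed
  qed simp_all
  have "\<forall>\<^sub>F n in sequentially. \<forall>p\<in>C. norm (r n p) < e / 2"
  proof (rule eventually_ball_finite[OF C(2)], rule ballI)
    fix p assume "p \<in> C"
    then have "(\<lambda>n. r n p) \<longlonglongrightarrow> 0" using lim C by blast
    from tendstoD[OF this, of "e / 2"] show "\<forall>\<^sub>F n in sequentially. norm (r n p) < e / 2"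
      using \<open>e > 0\<close> by simp
  qed
  then show ?thesis
  proof (rule eventually_mono, intro ballI)
    fix n q assume n: "\<forall>p\<in>C. norm (r n p) < e / 2" and q: "q \<in> S"
    then obtain p where p: "p \<in> C" "dist q p < d p" using C by (auto simp: dist_commute)
    have "norm (r n q) \<le> norm (r n q - r n p) + norm (r n p)"
      using norm_triangle_ineq[of "r n q - r n p" "r n p"] by simp
    also have "\<dots> < e / 2 + e / 2"
      using d(2)[of p q n] p q C n by (intro add_strict_mono) auto
    finally show "norm (r n q) < e" by simp
  qed
qed

text \<open>Weak convergence is phrased with the Bochner integral, perturbations with the gauge
  integral; bounded measurable test functions allow the exchange.\<close>

lemma L2_inner_eq_integral:
  assumes "u absolutely_integrable_on {0..1}" "v \<in> borel_measurable (lebesgue_on {0..1})" "bounded (v ` {0..1})"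
  shows "(\<lambda>s. u s \<bullet> v s) integrable_on {0..1}" "L2_inner u v = integral {0..1} (\<lambda>s. u s \<bullet> v s)"
proof -
  have "(\<lambda>s. v s \<bullet> u s) absolutely_integrable_on {0..1}"
    by (rule absolutely_integrable_bounded_measurable_product[OF _ assms(2) _ assms(3,1)])
      (auto simp: bilinear_conv_bounded_bilinear bounded_bilinear_inner)
  then have *: "(\<lambda>s. u s \<bullet> v s) absolutely_integrable_on {0..1}" by (simp add: inner_commute)
  show "(\<lambda>s. u s \<bullet> v s) integrable_on {0..1}"
    using * by (rule set_lebesgue_integral_eq_integral(1))
  show "L2_inner u v = integral {0..1} (\<lambda>s. u s \<bullet> v s)"
    unfolding L2_inner_def
    by (rule lebesgue_integral_eq_integral[OF absolutely_integrable_imp_integrable[OF *]]) auto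
qed

context control_system
begin

lemma trajectory_equicontinuous_param:
  assumes u: "u \<in> L2_controls" and \<theta>0: "\<theta>0 \<in> \<Theta>" and "e > 0"
  obtains d where "d > 0" "\<And>\<theta> t. \<theta> \<in> \<Theta> \<Longrightarrow> dist \<theta> \<theta>0 < d \<Longrightarrow> t \<in> {0..1} \<Longrightarrow>
     norm (trajectory F0 F x0 u \<theta> t - trajectory F0 F x0 u \<theta>0 t) < e"
proof -
  \<comment> \<open>The stability bound as a continuous function of the parameter, vanishing at
    \<theta>0 and free of t.\<close>
  define b where "b \<theta> = 2 * (norm (x0 \<theta> - x0 \<theta>0) + integral {0..1} (modulus u) * norm (\<theta> - \<theta>0)) * exp (growth (L2_norm u))" for \<theta>
  have "continuous_on \<Theta> b"
    unfolding b_def[abs_def] by (intro continuous_intros continuous_x0)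
  then obtain d where "d > 0" and d: "\<And>\<theta>. \<theta> \<in> \<Theta> \<Longrightarrow> dist \<theta> \<theta>0 < d \<Longrightarrow> dist (b \<theta>) (b \<theta>0) < e"
    using \<theta>0 \<open>e > 0\<close> unfolding continuous_on_iff by meson
  show ?thesis
  proof (rule that[OF \<open>d > 0\<close>])
    fix \<theta> and t :: real assume *: "\<theta> \<in> \<Theta>" "dist \<theta> \<theta>0 < d" "t \<in> {0..1}"
    have "norm (trajectory F0 F x0 u \<theta> t - trajectory F0 F x0 u \<theta>0 t) \<le> b \<theta>"
      unfolding b_def using * \<theta>0 u
      by (intro integral_solution_stability integral_solution_trajectory) auto
    also have "\<dots> < e"
      using d[OF *(1,2)] by (simp add: b_def dist_real_def)
    finally show "norm (trajectory F0 F x0 u \<theta> t - trajectory F0 F x0 u \<theta>0 t) < e" .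
  qed
qed

lemma continuous_trajectory_time:
  assumes "\<theta> \<in> \<Theta>" "u \<in> L2_controls"
  shows "continuous_on {0..1} (trajectory F0 F x0 u \<theta>)"
  using integral_solution_trajectory[OF assms] by (simp add: integral_solution_def)

text \<open>Continuity in the parameter is uniform in time, so continuity in time at the single
  parameter \<theta>0 upgrades it to joint continuity.\<close>

lemma continuous_trajectory:
  assumes u: "u \<in> L2_controls"
  shows "continuous_on ({0..1} \<times> \<Theta>) (\<lambda>(t, \<theta>). trajectory F0 F x0 u \<theta> t)"
  unfolding continuous_on_iff
proof (intro ballI allI impI)
  let ?X = "trajectory F0 F x0 u"
  fix p :: "real \<times> 'p" and e :: real assume p: "p \<in> {0..1} \<times> \<Theta>" and "e > 0"
  obtain t0 \<theta>0 where p_eq: "p = (t0, \<theta>0)" by fastforce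
  have t0: "t0 \<in> {0..1}" "\<theta>0 \<in> \<Theta>" using p p_eq by auto
  obtain d1 where "d1 > 0" and d1: "\<And>\<theta> t. \<theta> \<in> \<Theta> \<Longrightarrow> dist \<theta> \<theta>0 < d1 \<Longrightarrow> t \<in> {0..1} \<Longrightarrow> norm (?X \<theta> t - ?X \<theta>0 t) < e / 2"
    using trajectory_equicontinuous_param[OF u t0(2), of "e / 2"] \<open>e > 0\<close> by auto
  have "e / 2 > 0" using \<open>e > 0\<close> by simp
  with continuous_trajectory_time[OF t0(2) u] t0(1)
  obtain d2 where "d2 > 0" and d2: "\<And>t. t \<in> {0..1} \<Longrightarrow> dist t t0 < d2 \<Longrightarrow> dist (?X \<theta>0 t) (?X \<theta>0 t0) < e / 2"
    unfolding continuous_on_iff by meson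
  show "\<exists>d>0. \<forall>q\<in>{0..1} \<times> \<Theta>. dist q p < d \<longrightarrow>
     dist (case q of (t, \<theta>) \<Rightarrow> ?X \<theta> t) (case p of (t, \<theta>) \<Rightarrow> ?X \<theta> t) < e"
  proof (intro exI[of _ "min d1 d2"] conjI ballI impI)
    show "min d1 d2 > 0" using \<open>d1 > 0\<close> \<open>d2 > 0\<close> by simp
    fix q assume q: "q \<in> {0..1} \<times> \<Theta>" "dist q p < min d1 d2"
    obtain t \<theta> where q_eq: "q = (t, \<theta>)" by fastforce
    have "dist t t0 < d2" "dist \<theta> \<theta>0 < d1"
      using q(2) dist_fst_le[of q p] dist_snd_le[of q p] by (auto simp: q_eq p_eq)
    then have "dist (?X \<theta> t) (?X \<theta>0 t) < e / 2" "dist (?X \<theta>0 t) (?X \<theta>0 t0) < e / 2"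
      using d1 d2 q q_eq by (auto simp: dist_norm)
    then show "dist (case q of (t, \<theta>) \<Rightarrow> ?X \<theta> t) (case p of (t, \<theta>) \<Rightarrow> ?X \<theta> t) < e"
      using dist_triangle[of "?X \<theta> t" "?X \<theta>0 t0" "?X \<theta>0 t"] by (simp add: q_eq p_eq)
  qed
qed

text \<open>
  The effect, to first order along the trajectory of \<open>u\<close>, of perturbing the control by \<open>w\<close>. It is
  linear in \<open>w\<close> and therefore accessible to weak convergence.
\<close>

definition perturbation :: "(real \<Rightarrow> real ^ 'k) \<Rightarrow> (real \<Rightarrow> real ^ 'k) \<Rightarrow> real \<times> 'p \<Rightarrow> real ^ 'n" where
  "perturbation u w = (\<lambda>(t, \<theta>). integral {0..t} (\<lambda>s. F (trajectory F0 F x0 u \<theta> s) \<theta> *v w s))"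

lemma perturbation_integrable:
  assumes "u \<in> L2_controls" "w absolutely_integrable_on {0..1}" "\<theta> \<in> \<Theta>" "0 \<le> a" "b \<le> 1"
  shows "(\<lambda>s. F (trajectory F0 F x0 u \<theta> s) \<theta> *v w s) integrable_on {a..b}"
proof -
  have sub: "{a..b} \<subseteq> {0..1}" using assms by auto
  have "(\<lambda>s. F (trajectory F0 F x0 u \<theta> s) \<theta> *v w s) absolutely_integrable_on {a..b}"
    using continuous_on_subset[OF continuous_trajectory_time[OF assms(3,1)] sub] assms(3)
      absolutely_integrable_on_subinterval[OF assms(2) sub]
    by (rule F_mult_absolutely_integrable)
  then show ?thesis by (rule set_lebesgue_integral_eq_integral(1))
qed

text \<open>The radius depends on w only through W, as needed for a whole sequence. The move from p
  to q is split at (t, \<theta>0): changing the parameter is controlled by the Lipschitz bound for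
  F, changing the time by Young's inequality on a short interval.\<close>

lemma perturbation_equicontinuous:
  assumes u: "u \<in> L2_controls" and p: "p \<in> {0..1} \<times> \<Theta>" and "e > 0"
  shows "\<exists>d>0. \<forall>q\<in>{0..1} \<times> \<Theta>. dist q p < d \<longrightarrow> (\<forall>w. w absolutely_integrable_on {0..1} \<longrightarrow>
     (\<lambda>s. (norm (w s))\<^sup>2) integrable_on {0..1} \<longrightarrow> integral {0..1} (\<lambda>s. (norm (w s))\<^sup>2) \<le> W \<longrightarrow>
     norm (perturbation u w q - perturbation u w p) < e)"
proof -
  let ?X = "trajectory F0 F x0 u"
  obtain t0 \<theta>0 where p_eq: "p = (t0, \<theta>0)" by fastforce
  have t0: "t0 \<in> {0..1}" "\<theta>0 \<in> \<Theta>" using p p_eq by auto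
  \<comment> \<open>Being at least 1, W' absorbs the length term when Young's inequality is applied
    with l = 1 on {0..t}.\<close>
  define W' where "W' = \<bar>W\<bar> + 1"
  have "W' > 0" "W \<le> W'" by (auto simp: W'_def)
  define C where "C = real CARD('k) * L"
  have "C > 0" using L_pos by (simp add: C_def)
  \<comment> \<open>State and parameter each move by less than \<eta>, so the parameter step costs
    at most C * (2 * \<eta>) * W' = e / 2.\<close>
  define \<eta> where "\<eta> = e / 2 / (2 * C * W')"
  have "\<eta> > 0" using \<open>e > 0\<close> \<open>C > 0\<close> \<open>W' > 0\<close> by (simp add: \<eta>_def)
  obtain d1 where "d1 > 0" and d1: "\<And>\<theta> t. \<theta> \<in> \<Theta> \<Longrightarrow> dist \<theta> \<theta>0 < d1 \<Longrightarrow> t \<in> {0..1} \<Longrightarrow> norm (?X \<theta> t - ?X \<theta>0 t) < \<eta>"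
    using trajectory_equicontinuous_param[OF u t0(2) \<open>\<eta> > 0\<close>] by metis
  obtain R where R: "\<And>s. s \<in> {0..1} \<Longrightarrow> norm (?X \<theta>0 s) \<le> R"
    using compact_imp_bounded[OF compact_continuous_image[OF continuous_trajectory_time[OF t0(2) u] compact_Icc]]
    unfolding bounded_iff by blast
  obtain M where "M > 0" and M: "\<And>y p v. norm y \<le> R \<Longrightarrow> p \<in> \<Theta> \<Longrightarrow> norm (F y p *v v) \<le> M * norm v"
    using F_bound[of R] by metis
  \<comment> \<open>With l and d2 so chosen, M * W' / (2 * l) and M * l * d2 / 2 both equal e /
    4.\<close>
  define l where "l = 2 * M * W' / e"
  have "l > 0" using \<open>e > 0\<close> \<open>M > 0\<close> \<open>W' > 0\<close> by (simp add: l_def)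
  define d2 where "d2 = e / (2 * M * l)"
  have "d2 > 0" using \<open>e > 0\<close> \<open>M > 0\<close> \<open>l > 0\<close> by (simp add: d2_def)
  show ?thesis
  proof (intro exI[of _ "min (min d1 \<eta>) d2"] conjI ballI allI impI)
    show "min (min d1 \<eta>) d2 > 0" using \<open>d1 > 0\<close> \<open>d2 > 0\<close> \<open>\<eta> > 0\<close> by simp
    fix q and w :: "real \<Rightarrow> real ^ 'k" assume q: "q \<in> {0..1} \<times> \<Theta>" "dist q p < min (min d1 \<eta>) d2"
      and w: "w absolutely_integrable_on {0..1}" "(\<lambda>s. (norm (w s))\<^sup>2) integrable_on {0..1}"
        "integral {0..1} (\<lambda>s. (norm (w s))\<^sup>2) \<le> W"
    obtain t \<theta> where q_eq: "q = (t, \<theta>)" by fastforce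
    have t: "t \<in> {0..1}" "\<theta> \<in> \<Theta>" using q q_eq by auto
    have near: "dist t t0 < d2" "dist \<theta> \<theta>0 < d1" "dist \<theta> \<theta>0 < \<eta>"
      using q(2) dist_fst_le[of q p] dist_snd_le[of q p] by (auto simp: q_eq p_eq)
    have nw: "(\<lambda>s. norm (w s)) integrable_on {a..b}" if "0 \<le> a" "b \<le> 1" for a b
    proof (rule integrable_on_subinterval)
      show "(\<lambda>s. norm (w s)) integrable_on {0..1}"
        using w(1) by (simp add: absolutely_integrable_on_def)
    qed (use that in auto)
    have nw2: "(\<lambda>s. (norm (w s))\<^sup>2) integrable_on {a..b}" if "0 \<le> a" "b \<le> 1" for a b
      using w(2) by (rule integrable_on_subinterval) (use that in auto)
    have young: "integral {a..b} (\<lambda>s. norm (w s)) \<le> l / 2 * (b - a) + W' / (2 * l)"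
      if "0 \<le> a" "a \<le> b" "b \<le> 1" "l > 0" for a b l
    proof -
      have "integral {a..b} (\<lambda>s. norm (w s)) \<le> l / 2 * (b - a) + integral {a..b} (\<lambda>s. (norm (w s))\<^sup>2) / (2 * l)"
        using nw nw2 that by (intro integral_le_young) auto
      also have "integral {a..b} (\<lambda>s. (norm (w s))\<^sup>2) \<le> integral {0..1} (\<lambda>s. (norm (w s))\<^sup>2)"
        using nw2 that by (intro integral_subset_le) auto
      then have "integral {a..b} (\<lambda>s. (norm (w s))\<^sup>2) / (2 * l) \<le> W' / (2 * l)"
        using w(3) \<open>W \<le> W'\<close> that by (intro divide_right_mono) auto
      finally show ?thesis by simp
    qed
    have "norm (perturbation u w (t, \<theta>) - perturbation u w (t, \<theta>0)) =
        norm (integral {0..t} (\<lambda>s. F (?X \<theta> s) \<theta> *v w s - F (?X \<theta>0 s) \<theta>0 *v w s))"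
      using perturbation_integrable[OF u w(1)] t t0
      by (simp add: perturbation_def Henstock_Kurzweil_Integration.integral_diff)
    also have "\<dots> \<le> integral {0..t} (\<lambda>s. C * (2 * \<eta>) * norm (w s))"
    proof (rule Henstock_Kurzweil_Integration.integral_norm_bound_integral)
      show "(\<lambda>s. F (?X \<theta> s) \<theta> *v w s - F (?X \<theta>0 s) \<theta>0 *v w s) integrable_on {0..t}"
        using perturbation_integrable[OF u w(1)] t t0 by (intro integrable_diff) auto
      show "(\<lambda>s. C * (2 * \<eta>) * norm (w s)) integrable_on {0..t}"
        using nw t by (intro integrable_on_mult_right) auto
      fix s assume s: "s \<in> {0..t}"
      have "norm (F (?X \<theta> s) \<theta> *v w s - F (?X \<theta>0 s) \<theta>0 *v w s) \<le>
          C * (norm (?X \<theta> s - ?X \<theta>0 s) + norm (\<theta> - \<theta>0)) * norm (w s)"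
        unfolding C_def by (rule norm_F_diff_mult[OF t(2) t0(2)])
      also have "\<dots> \<le> C * (2 * \<eta>) * norm (w s)"
        using d1[OF t(2) near(2), of s] near(3) s t(1) \<open>C > 0\<close>
        by (intro mult_right_mono mult_left_mono) (auto simp: dist_norm)
      finally show "norm (F (?X \<theta> s) \<theta> *v w s - F (?X \<theta>0 s) \<theta>0 *v w s) \<le> C * (2 * \<eta>) * norm (w s)" .
    qed
    also have "\<dots> = C * (2 * \<eta>) * integral {0..t} (\<lambda>s. norm (w s))" by simp
    also have "\<dots> \<le> C * (2 * \<eta>) * (1 / 2 * (t - 0) + W' / (2 * 1))"
      using young[of 0 t 1] t \<open>C > 0\<close> \<open>\<eta> > 0\<close> by (intro mult_left_mono) auto
    also have "\<dots> \<le> C * (2 * \<eta>) * W'"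
      using t \<open>C > 0\<close> \<open>\<eta> > 0\<close> by (intro mult_left_mono) (auto simp: W'_def field_simps)
    also have "\<dots> = e / 2"
      using \<open>C > 0\<close> \<open>W' > 0\<close> by (simp add: \<eta>_def)
    finally have part1: "norm (perturbation u w (t, \<theta>) - perturbation u w (t, \<theta>0)) \<le> e / 2" .
    have segment: "norm (perturbation u w (b, \<theta>0) - perturbation u w (a, \<theta>0)) < e / 2"
      if ab: "0 \<le> a" "a \<le> b" "b \<le> 1" "b - a < d2" for a b
    proof -
      have "perturbation u w (b, \<theta>0) - perturbation u w (a, \<theta>0) = integral {a..b} (\<lambda>s. F (?X \<theta>0 s) \<theta>0 *v w s)"
        using Henstock_Kurzweil_Integration.integral_combine[OF ab(1,2) perturbation_integrable[OF u w(1) t0(2)]] ab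
        by (simp add: perturbation_def algebra_simps)
      also have "norm \<dots> \<le> integral {a..b} (\<lambda>s. M * norm (w s))"
        using perturbation_integrable[OF u w(1) t0(2)] nw ab M[OF R t0(2)]
        by (intro Henstock_Kurzweil_Integration.integral_norm_bound_integral integrable_on_mult_right) auto
      also have "\<dots> = M * integral {a..b} (\<lambda>s. norm (w s))" by simp
      also have "\<dots> \<le> M * (l / 2 * (b - a) + W' / (2 * l))"
        using young ab \<open>M > 0\<close> \<open>l > 0\<close> by (intro mult_left_mono) auto
      also have "\<dots> < M * (l / 2 * d2 + W' / (2 * l))"
        using ab \<open>M > 0\<close> \<open>l > 0\<close> by simp
      also have "\<dots> = e / 4 + e / 4"
      proof -
        have "M * (l / 2 * d2) = e / 4" using \<open>M > 0\<close> \<open>l > 0\<close> by (simp add: d2_def)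
        moreover have "M * (W' / (2 * l)) = e / 4"
          using \<open>M > 0\<close> \<open>W' > 0\<close> \<open>e > 0\<close> by (simp add: l_def)
        ultimately show ?thesis by (simp only: distrib_left)
      qed
      finally show ?thesis by simp
    qed
    have "norm (perturbation u w (t, \<theta>0) - perturbation u w (t0, \<theta>0)) < e / 2"
    proof (cases "t0 \<le> t")
      case True
      then show ?thesis using segment[of t0 t] t t0 near(1) by (simp add: dist_real_def)
    next
      case False
      then show ?thesis using segment[of t t0] t t0 near(1) by (simp add: dist_real_def norm_minus_commute)
    qed
    then show "norm (perturbation u w q - perturbation u w p) < e"
      using part1 norm_triangle_ineq[of "perturbation u w (t, \<theta>) - perturbation u w (t, \<theta>0)"
        "perturbation u w (t, \<theta>0) - perturbation u w (t0, \<theta>0)"]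
      by (simp add: q_eq p_eq)
  qed
qed

text \<open>Each component is a weak pairing: its test function v is a row of F along the fixed
  trajectory, cut off after time t, which is bounded and therefore in L2.\<close>

lemma perturbation_tendsto_0:
  assumes u: "u \<in> L2_controls" and uN: "\<And>n. uN n \<in> L2_controls"
    and weak: "\<And>v. v \<in> L2_controls \<Longrightarrow> (\<lambda>n. L2_inner (uN n) v) \<longlonglongrightarrow> L2_inner u v"
    and t: "t \<in> {0..1}" and \<theta>: "\<theta> \<in> \<Theta>"
  shows "(\<lambda>n. perturbation u (\<lambda>s. uN n s - u s) (t, \<theta>)) \<longlonglongrightarrow> 0"
proof (rule vec_tendstoI)
  fix i
  let ?A = "\<lambda>s. F (trajectory F0 F x0 u \<theta> s) \<theta>"
  define v where "v s = indicator {0..t} s *\<^sub>R (?A s $ i)" for s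
  have cA: "continuous_on {0..1} (\<lambda>s. ?A s $ i)"
    using continuous_along(2)[OF continuous_trajectory_time[OF \<theta> u] \<theta>] by (intro continuous_intros)
  have v_meas: "v \<in> borel_measurable (lebesgue_on {0..1})"
    unfolding v_def[abs_def]
  proof (rule borel_measurable_scaleR)
    show "(\<lambda>s. ?A s $ i) \<in> borel_measurable (lebesgue_on {0..1})"
      using cA by (rule continuous_imp_measurable_on_sets_lebesgue) auto
    show "(\<lambda>s. indicator {0..t} s :: real) \<in> borel_measurable (lebesgue_on {0..1})"
      by (intro borel_measurable_indicator) (use t in \<open>auto simp: sets_restrict_space\<close>)
  qed
  obtain B where B: "\<And>s. s \<in> {0..1} \<Longrightarrow> norm (?A s $ i) \<le> B"
    using compact_imp_bounded[OF compact_continuous_image[OF cA compact_Icc]] unfolding bounded_iff by blast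
  have "B \<ge> 0" using order_trans[OF norm_ge_zero B[of 0]] by simp
  have vB: "norm (v s) \<le> B" if "s \<in> {0..1}" for s
    using B[OF that] \<open>B \<ge> 0\<close> by (simp add: v_def indicator_def)
  have v_bdd: "bounded (v ` {0..1})"
    using vB by (intro boundedI[of _ B]) blast
  have v: "v \<in> L2_controls"
  proof -
    interpret finite_measure "lebesgue_on {0..1::real}"
      by (rule finite_measure_lebesgue_on) auto
    have "integrable (lebesgue_on {0..1}) (\<lambda>s. (norm (v s))\<^sup>2)"
    proof (rule integrable_const_bound[of _ "B\<^sup>2"])
      show "AE s in lebesgue_on {0..1}. norm ((norm (v s))\<^sup>2) \<le> B\<^sup>2"
        using vB by (intro AE_I2) (auto intro!: power_mono)
    qed (use v_meas in measurable)
    then show ?thesis using v_meas by (simp add: L2_controls_def)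
  qed
  have "perturbation u (\<lambda>s. uN n s - u s) (t, \<theta>) $ i = L2_inner (uN n) v - L2_inner u v" for n
  proof -
    have w: "(\<lambda>s. uN n s - u s) absolutely_integrable_on {0..1}"
      using L2_controls_integrable(1) u uN by (intro set_integral_diff(1)) auto
    have "perturbation u (\<lambda>s. uN n s - u s) (t, \<theta>) $ i = integral {0..t} (\<lambda>s. (?A s *v (uN n s - u s)) $ i)"
      using perturbation_integrable[OF u w \<theta>, of 0 t] t
      by (simp add: perturbation_def integral_component_eq_cart)
    also have "\<dots> = integral {0..t} (\<lambda>s. uN n s \<bullet> v s - u s \<bullet> v s)"
      by (rule Henstock_Kurzweil_Integration.integral_cong)
        (simp add: matrix_vector_mul_component v_def inner_diff_left inner_commute)
    also have "\<dots> = integral {0..1} (\<lambda>s. uN n s \<bullet> v s - u s \<bullet> v s)"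
    proof -
      have "{s \<in> {0..t} - {0..1}. uN n s \<bullet> v s - u s \<bullet> v s \<noteq> 0} = {}"
        "{s \<in> {0..1} - {0..t}. uN n s \<bullet> v s - u s \<bullet> v s \<noteq> 0} = {}"
        using t by (auto simp: v_def)
      then show ?thesis by (intro integral_spike_set) (simp_all only: negligible_empty)
    qed
    also have "\<dots> = L2_inner (uN n) v - L2_inner u v"
      using L2_inner_eq_integral[OF L2_controls_integrable(1)[OF u] v_meas v_bdd]
        L2_inner_eq_integral[OF L2_controls_integrable(1)[OF uN] v_meas v_bdd]
      by (simp add: Henstock_Kurzweil_Integration.integral_diff)
    finally show ?thesis .
  qed
  then show "(\<lambda>n. perturbation u (\<lambda>s. uN n s - u s) (t, \<theta>) $ i) \<longlonglongrightarrow> 0 $ i"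
    using tendsto_diff[OF weak[OF v] tendsto_const[of "L2_inner u v"]] by simp
qed

theorem trajectory_uniform_limit:
  assumes u: "u \<in> L2_controls" and uN: "\<And>n. uN n \<in> L2_controls" "\<And>n. L2_norm (uN n) \<le> r"
    and weak: "\<And>v. v \<in> L2_controls \<Longrightarrow> (\<lambda>n. L2_inner (uN n) v) \<longlonglongrightarrow> L2_inner u v"
    and "e > 0"
  shows "\<forall>\<^sub>F n in sequentially. \<forall>\<theta>\<in>\<Theta>. \<forall>t\<in>{0..1}.
    norm (trajectory F0 F x0 (uN n) \<theta> t - trajectory F0 F x0 u \<theta> t) < e"
proof -
  let ?X = "trajectory F0 F x0"
  let ?w = "\<lambda>n s. uN n s - u s"
  \<comment> \<open>The parallelogram law bounds the squared norm of a difference by twice the sum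
    of the squared norms.\<close>
  define W where "W = 2 * r\<^sup>2 + 2 * (L2_norm u)\<^sup>2"
  have w1: "?w n absolutely_integrable_on {0..1}" for n
    using L2_controls_integrable(1) u uN by (intro set_integral_diff(1)) auto
  have w2: "(\<lambda>s. (norm (?w n s))\<^sup>2) integrable_on {0..1}"
    and w3: "integral {0..1} (\<lambda>s. (norm (?w n s))\<^sup>2) \<le> W" for n
  proof -
    note i = L2_controls_integrable[OF uN(1), of n] L2_controls_integrable[OF u]
    have le: "(norm (?w n s))\<^sup>2 \<le> 2 * (norm (uN n s))\<^sup>2 + 2 * (norm (u s))\<^sup>2" for s
    proof -
      have "(norm (?w n s))\<^sup>2 + (norm (uN n s + u s))\<^sup>2 = 2 * (norm (uN n s))\<^sup>2 + 2 * (norm (u s))\<^sup>2"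
        by (simp add: power2_norm_eq_inner inner_diff inner_add inner_commute algebra_simps)
      then show ?thesis by (smt (verit) zero_le_power2)
    qed
    have sum: "(\<lambda>s. 2 * (norm (uN n s))\<^sup>2 + 2 * (norm (u s))\<^sup>2) integrable_on {0..1}"
      using i by (intro integrable_add integrable_on_mult_right) auto
    have "?w n \<in> borel_measurable (lebesgue_on {0..1})"
      using u uN(1)[of n] by (auto simp: L2_controls_def)
    then have "(\<lambda>s. (norm (?w n s))\<^sup>2) \<in> borel_measurable (lebesgue_on {0..1})"
      by measurable
    then show w2: "(\<lambda>s. (norm (?w n s))\<^sup>2) integrable_on {0..1}"
      by (rule measurable_bounded_by_integrable_imp_integrable[OF _ sum]) (use le in auto)
    have "integral {0..1} (\<lambda>s. (norm (?w n s))\<^sup>2) \<le> integral {0..1} (\<lambda>s. 2 * (norm (uN n s))\<^sup>2 + 2 * (norm (u s))\<^sup>2)"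
      by (intro integral_le w2 sum le)
    also have "\<dots> = 2 * (L2_norm (uN n))\<^sup>2 + 2 * (L2_norm u)\<^sup>2"
      using i by (subst Henstock_Kurzweil_Integration.integral_add) (auto intro!: integrable_on_mult_right)
    also have "\<dots> \<le> W"
      using power_mono[OF uN(2), of n 2] by (simp add: W_def L2_norm_def)
    finally show "integral {0..1} (\<lambda>s. (norm (?w n s))\<^sup>2) \<le> W" .
  qed
  \<comment> \<open>Gronwall's factor 2 * exp (growth r) turns this \<epsilon> into e / 2.\<close>
  define \<epsilon> where "\<epsilon> = e / 4 / exp (growth r)"
  have "\<epsilon> > 0" using \<open>e > 0\<close> by (simp add: \<epsilon>_def)
  have "\<forall>\<^sub>F n in sequentially. \<forall>p\<in>{0..1} \<times> \<Theta>. norm (perturbation u (?w n) p) < \<epsilon>"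
  proof (rule pointwise_limit_equicontinuous_imp_uniform[OF compact_Times[OF compact_Icc compact_param] _ _ \<open>\<epsilon> > 0\<close>])
    fix p :: "real \<times> 'p" and e :: real assume p: "p \<in> {0..1} \<times> \<Theta>"
    then show "(\<lambda>n. perturbation u (?w n) p) \<longlonglongrightarrow> 0"
      using perturbation_tendsto_0[OF u uN(1) weak] by (cases p) auto
    assume "e > 0"
    then show "\<exists>d>0. \<forall>q\<in>{0..1} \<times> \<Theta>. dist q p < d \<longrightarrow> (\<forall>n. norm (perturbation u (?w n) q - perturbation u (?w n) p) < e)"
      using perturbation_equicontinuous[OF u p \<open>e > 0\<close>, of W] w1 w2 w3 by meson
  qed
  then show ?thesis
  proof (rule eventually_mono, intro ballI)
    fix n \<theta> and t :: real
    assume small: "\<forall>p\<in>{0..1} \<times> \<Theta>. norm (perturbation u (?w n) p) < \<epsilon>" and \<theta>: "\<theta> \<in> \<Theta>" and t: "t \<in> {0..1}"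
    let ?x = "?X (uN n) \<theta>" and ?y = "?X u \<theta>"
    have cont: "continuous_on {0..1} ?x" "continuous_on {0..1} ?y"
      using continuous_trajectory_time \<theta> u uN by auto
    have "norm (?x t - ?y t) \<le> 2 * \<epsilon> * exp (growth r)"
    proof (rule norm_diff_le_of_modulus[OF uN cont _ t])
      fix t :: real assume t: "t \<in> {0..1}"
      have sub: "{0..t} \<subseteq> {0..1}" using t by auto
      have m1: "modulus (uN n) absolutely_integrable_on {0..t}"
        using modulus_integrable(1)[OF uN(1)] sub by (rule absolutely_integrable_on_subinterval)
      have mx: "(\<lambda>s. modulus (uN n) s * norm (?x s - ?y s)) integrable_on {0..t}"
        using m1 cont sub by (intro set_lebesgue_integral_eq_integral(1) continuous_times_absolutely_integrable)
          (auto intro!: continuous_intros intro: continuous_on_subset)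
      have ix: "(\<lambda>s. rhs (uN n) \<theta> s (?x s)) integrable_on {0..t}"
        and ixy: "(\<lambda>s. rhs (uN n) \<theta> s (?y s)) integrable_on {0..t}"
        and iy: "(\<lambda>s. rhs u \<theta> s (?y s)) integrable_on {0..t}"
        using rhs_integrable cont \<theta> u uN sub by auto
      have pert: "perturbation u (?w n) (t, \<theta>) = integral {0..t} (\<lambda>s. rhs (uN n) \<theta> s (?y s) - rhs u \<theta> s (?y s))"
        by (simp add: perturbation_def rhs_def matrix_vector_mult_diff_distrib)
      have "?x t - ?y t = integral {0..t} (\<lambda>s. rhs (uN n) \<theta> s (?x s)) - integral {0..t} (\<lambda>s. rhs u \<theta> s (?y s))"
        using integral_solution_trajectory[OF \<theta>] u uN t by (simp add: integral_solution_def)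
      \<comment> \<open>The velocity of the moving control along the limit trajectory is inserted.
        Its difference from the limit velocity is free of F0 and is exactly the perturbation; the
        remainder is Lipschitz in the state.\<close>
      then have split: "?x t - ?y t = perturbation u (?w n) (t, \<theta>) +
          integral {0..t} (\<lambda>s. rhs (uN n) \<theta> s (?x s) - rhs (uN n) \<theta> s (?y s))"
        unfolding pert using ix ixy iy by (simp add: Henstock_Kurzweil_Integration.integral_diff)
      have "norm (?x t - ?y t) \<le> norm (perturbation u (?w n) (t, \<theta>)) +
          norm (integral {0..t} (\<lambda>s. rhs (uN n) \<theta> s (?x s) - rhs (uN n) \<theta> s (?y s)))"
        unfolding split by (rule norm_triangle_ineq)
      moreover have "norm (integral {0..t} (\<lambda>s. rhs (uN n) \<theta> s (?x s) - rhs (uN n) \<theta> s (?y s))) \<le>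
          integral {0..t} (\<lambda>s. modulus (uN n) s * norm (?x s - ?y s))"
        using norm_rhs_diff[OF \<theta> \<theta>, of "uN n"]
        by (intro Henstock_Kurzweil_Integration.integral_norm_bound_integral integrable_diff ix ixy mx) simp
      moreover have "norm (perturbation u (?w n) (t, \<theta>)) \<le> \<epsilon>"
        using small t \<theta> by (intro less_imp_le) blast
      ultimately show "norm (?x t - ?y t) \<le> \<epsilon> + integral {0..t} (\<lambda>s. modulus (uN n) s * norm (?x s - ?y s))"
        by linarith
    qed
    also have "\<dots> < e" using \<open>e > 0\<close> by (simp add: \<epsilon>_def)
    finally show "norm (?x t - ?y t) < e" .
  qed
qed

end

section \<open>Convergence of the costs\<close>

text \<open>Expands 0 \<le> |a - u|^2. The left side is affine and weakly continuous in
  \<open>a\<close> and equals the right side at \<open>a = u\<close>, so weak lower semicontinuity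
  of the squared norm follows.\<close>

lemma L2_norm_weak_lower_bound:
  assumes a: "a \<in> L2_controls" and u: "u \<in> L2_controls"
  shows "2 * L2_inner a u - (L2_norm u)\<^sup>2 \<le> (L2_norm a)\<^sup>2"
proof -
  let ?M = "lebesgue_on {0..1::real}"
  have i: "integrable ?M (\<lambda>t. (norm (a t))\<^sup>2)" "integrable ?M (\<lambda>t. (norm (u t))\<^sup>2)"
    and m: "a \<in> borel_measurable ?M" "u \<in> borel_measurable ?M"
    using a u by (auto simp: L2_controls_def)
  have n: "(L2_norm v)\<^sup>2 = (\<integral>t. (norm (v t))\<^sup>2 \<partial>?M)" for v :: "real \<Rightarrow> real ^ 'k"
    by (simp add: L2_norm_def)
  have au: "integrable ?M (\<lambda>t. a t \<bullet> u t)"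
  proof (rule Bochner_Integration.integrable_bound[OF Bochner_Integration.integrable_add[OF i]])
    show "(\<lambda>t. a t \<bullet> u t) \<in> borel_measurable ?M" using m by measurable
    show "AE t in ?M. norm (a t \<bullet> u t) \<le> norm ((norm (a t))\<^sup>2 + (norm (u t))\<^sup>2)"
    proof (intro AE_I2)
      fix t
      have "\<bar>a t \<bullet> u t\<bar> \<le> norm (a t) * norm (u t)" by (rule Cauchy_Schwarz_ineq2)
      also have "\<dots> \<le> (norm (a t))\<^sup>2 + (norm (u t))\<^sup>2"
        using sum_squares_bound[of "norm (a t)" "norm (u t)"] mult_nonneg_nonneg[OF norm_ge_zero norm_ge_zero, of "a t" "u t"]
        by linarith
      finally show "norm (a t \<bullet> u t) \<le> norm ((norm (a t))\<^sup>2 + (norm (u t))\<^sup>2)" by simp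
    qed
  qed
  have "(\<integral>t. 2 * (a t \<bullet> u t) - (norm (u t))\<^sup>2 \<partial>?M) \<le> (\<integral>t. (norm (a t))\<^sup>2 \<partial>?M)"
  proof (rule integral_mono)
    fix t
    have "0 \<le> (norm (a t - u t))\<^sup>2" by simp
    then show "2 * (a t \<bullet> u t) - (norm (u t))\<^sup>2 \<le> (norm (a t))\<^sup>2"
      by (simp add: power2_norm_eq_inner inner_diff inner_commute)
  qed (use i au in auto)
  then show ?thesis using i au by (simp add: n L2_inner_def)
qed

lemma L2_inner_self: "L2_inner u u = (L2_norm u)\<^sup>2"
  by (simp add: L2_inner_def L2_norm_def power2_norm_eq_inner)

section \<open>Integrals of continuous functions against probability measures on compact
  sets\<close>

lemma borel_prob_on_integrable:
  fixes f :: "'a::topological_space \<Rightarrow> real"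
  assumes M: "borel_prob_on S M" and S: "compact S" and f: "continuous_on S f"
  shows "integrable M f"
proof -
  interpret prob_space M using M by (simp add: borel_prob_on_def)
  have sets: "sets M = sets (restrict_space borel S)" using M by (simp add: borel_prob_on_def)
  have space: "space M = S" using sets_eq_imp_space_eq[OF sets] by (simp add: space_restrict_space)
  obtain B where "\<And>s. s \<in> S \<Longrightarrow> norm (f s) \<le> B"
    using compact_imp_bounded[OF compact_continuous_image[OF f S]] unfolding bounded_iff by blast
  then have "AE s in M. norm (f s) \<le> B" by (intro AE_I2) (simp add: space)
  moreover have "f \<in> borel_measurable M"
    using borel_measurable_continuous_on_restrict[OF f] measurable_cong_sets[OF sets refl] by blast
  ultimately show ?thesis by (rule integrable_const_bound)
qed

text \<open>The bound is the same for every probability measure on S, so it also applies when the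
  measure moves with N.\<close>

lemma borel_prob_on_integral_diff_le:
  fixes f g :: "'a::topological_space \<Rightarrow> real"
  assumes M: "borel_prob_on S M" and S: "compact S" and f: "continuous_on S f" and g: "continuous_on S g"
    and le: "\<And>s. s \<in> S \<Longrightarrow> \<bar>f s - g s\<bar> \<le> e"
  shows "\<bar>(\<integral>s. f s \<partial>M) - (\<integral>s. g s \<partial>M)\<bar> \<le> e"
proof -
  interpret prob_space M using M by (simp add: borel_prob_on_def)
  have sets: "sets M = sets (restrict_space borel S)" using M by (simp add: borel_prob_on_def)
  have space: "space M = S" using sets_eq_imp_space_eq[OF sets] by (simp add: space_restrict_space)
  note i = borel_prob_on_integrable[OF M S f] borel_prob_on_integrable[OF M S g]
  have "\<bar>(\<integral>s. f s \<partial>M) - (\<integral>s. g s \<partial>M)\<bar> = \<bar>\<integral>s. f s - g s \<partial>M\<bar>"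
    using i by simp
  also have "\<dots> \<le> (\<integral>s. \<bar>f s - g s\<bar> \<partial>M)" by (rule integral_abs_bound)
  also have "\<dots> \<le> (\<integral>s. e \<partial>M)"
    using i le by (intro integral_mono) (auto simp: space)
  also have "\<dots> = e" by (simp add: prob_space)
  finally show ?thesis .
qed

text \<open>Uniform continuity on the compact product makes nearby integrands close uniformly in s,
  and integration against a probability measure preserves that.\<close>

lemma continuous_on_borel_prob_integral:
  fixes \<phi> :: "'a::metric_space \<Rightarrow> 'b::metric_space \<Rightarrow> real"
  assumes M: "borel_prob_on S M" and S: "compact S" and T: "compact T"
    and \<phi>: "continuous_on (S \<times> T) (\<lambda>(s, p). \<phi> s p)"
  shows "continuous_on T (\<lambda>p. \<integral>s. \<phi> s p \<partial>M)"
  unfolding continuous_on_iff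
proof (intro ballI allI impI)
  fix p and e :: real assume p: "p \<in> T" and "e > 0"
  have slice: "continuous_on S (\<lambda>s. \<phi> s q)" if "q \<in> T" for q
  proof -
    have "continuous_on S (\<lambda>s. (s, q))" by (intro continuous_intros)
    from continuous_on_compose2[OF \<phi> this] that show ?thesis by auto
  qed
  have "uniformly_continuous_on (S \<times> T) (\<lambda>(s, p). \<phi> s p)"
    using \<phi> compact_Times[OF S T] by (rule compact_uniformly_continuous)
  moreover have "e / 2 > 0" using \<open>e > 0\<close> by simp
  ultimately obtain d where "d > 0" and d: "\<And>x y. x \<in> S \<times> T \<Longrightarrow> y \<in> S \<times> T \<Longrightarrow> dist y x < d \<Longrightarrow>
      dist (case y of (s, p) \<Rightarrow> \<phi> s p) (case x of (s, p) \<Rightarrow> \<phi> s p) < e / 2"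
    unfolding uniformly_continuous_on_def by metis
  show "\<exists>d>0. \<forall>q\<in>T. dist q p < d \<longrightarrow> dist (\<integral>s. \<phi> s q \<partial>M) (\<integral>s. \<phi> s p \<partial>M) < e"
  proof (intro exI[of _ d] conjI ballI impI)
    fix q assume q: "q \<in> T" "dist q p < d"
    have "\<bar>(\<integral>s. \<phi> s q \<partial>M) - (\<integral>s. \<phi> s p \<partial>M)\<bar> \<le> e / 2"
    proof (rule borel_prob_on_integral_diff_le[OF M S slice[OF q(1)] slice[OF p]])
      fix s assume "s \<in> S"
      then show "\<bar>\<phi> s q - \<phi> s p\<bar> \<le> e / 2"
        using d[of "(s, p)" "(s, q)"] p q by (simp add: dist_prod_def dist_real_def)
    qed
    then show "dist (\<integral>s. \<phi> s q \<partial>M) (\<integral>s. \<phi> s p \<partial>M) < e"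
      using \<open>e > 0\<close> by (simp add: dist_real_def)
  qed (rule \<open>d > 0\<close>)
qed

lemma borel_prob_on_atomic_measure:
  assumes "\<And>j. j \<in> {1..N} \<Longrightarrow> \<theta> j \<in> \<Theta>" "\<And>j. j \<in> {1..N} \<Longrightarrow> \<alpha> j > 0" "(\<Sum>j=1..N. \<alpha> j) = 1"
  shows "borel_prob_on \<Theta> (atomic_measure \<Theta> N \<alpha> \<theta>)"
proof -
  have \<Theta>: "\<Theta> \<in> sets (restrict_space borel \<Theta>)"
    using sets.top[of "restrict_space borel \<Theta>"] by (simp add: space_restrict_space)
  have "emeasure (atomic_measure \<Theta> N \<alpha> \<theta>) \<Theta> = (\<Sum>j=1..N. ennreal (\<alpha> j))"
    unfolding emeasure_atomic_measure[OF \<Theta>] using assms(1) \<Theta> by (intro sum.cong refl) simp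
  also have "\<dots> = ennreal (\<Sum>j=1..N. \<alpha> j)"
    using assms(2) by (intro sum_ennreal) (auto intro: less_imp_le)
  finally show ?thesis
    using assms(3) by (auto simp: borel_prob_on_def intro!: prob_spaceI)
qed

text \<open>Replacing the moving integrand by the limit one costs at most its sup distance, whatever
  the measure; weak-star convergence then deals with the fixed integrand \<open>g u\<close>.\<close>

theorem (in control_system) running_cost_tendsto:
  fixes a :: "real \<Rightarrow> real ^ 'n \<Rightarrow> 'p \<Rightarrow> real"
  assumes u: "u \<in> L2_controls" and uN: "\<And>n. uN n \<in> L2_controls" "\<And>n. L2_norm (uN n) \<le> r"
    and weak: "\<And>v. v \<in> L2_controls \<Longrightarrow> (\<lambda>n. L2_inner (uN n) v) \<longlonglongrightarrow> L2_inner u v"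
    and a: "continuous_on ({0..1} \<times> UNIV \<times> \<Theta>) (\<lambda>(t, x, p). a t x p)"
    and \<nu>: "borel_prob_on {0..1} \<nu>"
    and MN: "\<forall>\<^sub>F n in sequentially. borel_prob_on \<Theta> (MN n)" and lim: "weak_star_converges \<Theta> MN \<mu>"
  shows "(\<lambda>n. \<integral>\<theta>. (\<integral>t. a t (trajectory F0 F x0 (uN n) \<theta> t) \<theta> \<partial>\<nu>) \<partial>MN n) \<longlonglongrightarrow>
    (\<integral>\<theta>. (\<integral>t. a t (trajectory F0 F x0 u \<theta> t) \<theta> \<partial>\<nu>) \<partial>\<mu>)"
proof -
  let ?X = "trajectory F0 F x0"
  define g where "g v \<theta> = (\<integral>t. a t (?X v \<theta> t) \<theta> \<partial>\<nu>)" for v \<theta>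
  have joint: "continuous_on ({0..1} \<times> \<Theta>) (\<lambda>(t, \<theta>). a t (?X v \<theta> t) \<theta>)" if v: "v \<in> L2_controls" for v
  proof -
    have "continuous_on ({0..1} \<times> \<Theta>) (\<lambda>p. (fst p, (case p of (t, \<theta>) \<Rightarrow> ?X v \<theta> t), snd p))"
      by (intro continuous_intros continuous_trajectory[OF v])
    from continuous_on_compose2[OF a this] show ?thesis
      by (simp add: case_prod_unfold image_subset_iff mem_Times_iff)
  qed
  have slice: "continuous_on {0..1} (\<lambda>t. a t (?X v \<theta> t) \<theta>)" if "v \<in> L2_controls" "\<theta> \<in> \<Theta>" for v \<theta>
  proof -
    have "continuous_on {0..1} (\<lambda>t. (t, \<theta>))" by (intro continuous_intros)
    from continuous_on_compose2[OF joint[OF that(1)] this] that(2) show ?thesis by auto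
  qed
  have g: "continuous_on \<Theta> (g v)" if "v \<in> L2_controls" for v
    unfolding g_def[abs_def]
    by (rule continuous_on_borel_prob_integral[OF \<nu> compact_Icc compact_param joint[OF that]])
  have g_lim: "(\<lambda>n. \<integral>\<theta>. g u \<theta> \<partial>MN n) \<longlonglongrightarrow> (\<integral>\<theta>. g u \<theta> \<partial>\<mu>)"
    using lim g[OF u] by (simp add: weak_star_converges_def)
  have close: "\<forall>\<^sub>F n in sequentially. \<forall>\<theta>\<in>\<Theta>. \<bar>g (uN n) \<theta> - g u \<theta>\<bar> \<le> e" if "e > 0" for e
  proof -
    obtain R where R: "\<And>p. p \<in> {0..1} \<times> \<Theta> \<Longrightarrow> norm (case p of (t, \<theta>) \<Rightarrow> ?X u \<theta> t) \<le> R"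
      using compact_imp_bounded[OF compact_continuous_image[OF continuous_trajectory[OF u]
        compact_Times[OF compact_Icc compact_param]]] unfolding bounded_iff by blast
    \<comment> \<open>\<open>a\<close> is uniformly continuous only on compact sets. Radius R + 1
      also contains the moving trajectories once they are within 1 of the limit, hence
      \<open>min d 1\<close> below.\<close>
    let ?K = "{0..1} \<times> cball 0 (R + 1) \<times> \<Theta> :: (real \<times> (real ^ 'n) \<times> 'p) set"
    have "uniformly_continuous_on ?K (\<lambda>(t, x, p). a t x p)"
      by (intro compact_uniformly_continuous continuous_on_subset[OF a] compact_Times compact_Icc
        compact_cball compact_param) auto
    then obtain d where "d > 0" and d: "\<And>p q. p \<in> ?K \<Longrightarrow> q \<in> ?K \<Longrightarrow> dist q p < d \<Longrightarrow>
        dist (case q of (t, x, p) \<Rightarrow> a t x p) (case p of (t, x, p) \<Rightarrow> a t x p) < e"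
      using \<open>e > 0\<close> unfolding uniformly_continuous_on_def by metis
    have "min d 1 > 0" using \<open>d > 0\<close> by simp
    with u uN weak have "\<forall>\<^sub>F n in sequentially. \<forall>\<theta>\<in>\<Theta>. \<forall>t\<in>{0..1}. norm (?X (uN n) \<theta> t - ?X u \<theta> t) < min d 1"
      by (rule trajectory_uniform_limit)
    then show ?thesis
    proof (rule eventually_mono, intro ballI)
      fix n \<theta>
      assume near: "\<forall>\<theta>\<in>\<Theta>. \<forall>t\<in>{0..1}. norm (?X (uN n) \<theta> t - ?X u \<theta> t) < min d 1" and \<theta>: "\<theta> \<in> \<Theta>"
      show "\<bar>g (uN n) \<theta> - g u \<theta>\<bar> \<le> e"
        unfolding g_def
      proof (rule borel_prob_on_integral_diff_le[OF \<nu> compact_Icc slice[OF uN(1) \<theta>] slice[OF u \<theta>]])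
        fix t :: real assume t: "t \<in> {0..1}"
        have close: "norm (?X (uN n) \<theta> t - ?X u \<theta> t) < min d 1" using near \<theta> t by blast
        have "norm (?X u \<theta> t) \<le> R" using R[of "(t, \<theta>)"] t \<theta> by simp
        moreover have "norm (?X (uN n) \<theta> t) \<le> norm (?X u \<theta> t) + norm (?X (uN n) \<theta> t - ?X u \<theta> t)"
          by (rule norm_triangle_sub)
        ultimately have "(t, ?X u \<theta> t, \<theta>) \<in> ?K" "(t, ?X (uN n) \<theta> t, \<theta>) \<in> ?K"
          using close t \<theta> by auto
        moreover have "dist (t, ?X (uN n) \<theta> t, \<theta>) (t, ?X u \<theta> t, \<theta>) < d"
          using close by (simp add: dist_prod_def dist_norm)
        ultimately show "\<bar>a t (?X (uN n) \<theta> t) \<theta> - a t (?X u \<theta> t) \<theta>\<bar> \<le> e"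
          using d by (force simp: dist_real_def)
      qed
    qed
  qed
  have "(\<lambda>n. (\<integral>\<theta>. g (uN n) \<theta> \<partial>MN n) - (\<integral>\<theta>. g u \<theta> \<partial>MN n)) \<longlonglongrightarrow> 0"
  proof (rule tendstoI)
    fix e :: real assume "e > 0"
    then have "e / 2 > 0" by simp
    from close[OF this] MN
    show "\<forall>\<^sub>F n in sequentially. dist ((\<integral>\<theta>. g (uN n) \<theta> \<partial>MN n) - (\<integral>\<theta>. g u \<theta> \<partial>MN n)) 0 < e"
    proof eventually_elim
      case (elim n)
      have "\<bar>(\<integral>\<theta>. g (uN n) \<theta> \<partial>MN n) - (\<integral>\<theta>. g u \<theta> \<partial>MN n)\<bar> \<le> e / 2"
        using elim by (intro borel_prob_on_integral_diff_le[OF _ compact_param g[OF uN(1)] g[OF u]]) auto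
      then show ?case using \<open>e > 0\<close> by (simp add: dist_real_def)
    qed
  qed
  from tendsto_add[OF this g_lim] show ?thesis by (simp add: g_def)
qed

theorem theorem3p3:
  fixes \<Theta> :: "'p::euclidean_space set"
    and F0 :: "real ^ 'n \<Rightarrow> 'p \<Rightarrow> real ^ 'n"
    and F :: "real ^ 'n \<Rightarrow> 'p \<Rightarrow> real ^ 'k ^ 'n"
    and x0 :: "'p \<Rightarrow> real ^ 'n"
    and a :: "real \<Rightarrow> real ^ 'n \<Rightarrow> 'p \<Rightarrow> real"
    and L \<beta> \<rho> :: real
    and \<nu> :: "real measure" and \<mu> :: "'p measure"
    and \<alpha> :: "nat \<Rightarrow> nat \<Rightarrow> real" and \<theta> :: "nat \<Rightarrow> nat \<Rightarrow> 'p"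
  defines "J \<equiv> ensemble_cost F0 F x0 a \<beta> \<nu> \<mu>"
    and "\<mu>N \<equiv> \<lambda>N. atomic_measure \<Theta> N (\<alpha> N) (\<theta> N)"
  assumes "compact \<Theta>"
    and "L > 0"
    and "\<And>x1 x2 \<theta>1 \<theta>2. \<theta>1 \<in> \<Theta> \<Longrightarrow> \<theta>2 \<in> \<Theta> \<Longrightarrow>
           norm (F0 x1 \<theta>1 - F0 x2 \<theta>2) \<le> L * (norm (x1 - x2) + norm (\<theta>1 - \<theta>2))"
    and "\<And>i x1 x2 \<theta>1 \<theta>2. \<theta>1 \<in> \<Theta> \<Longrightarrow> \<theta>2 \<in> \<Theta> \<Longrightarrow>
           norm (column i (F x1 \<theta>1) - column i (F x2 \<theta>2)) \<le> L * (norm (x1 - x2) + norm (\<theta>1 - \<theta>2))"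
    and "continuous_on \<Theta> x0"
    and "continuous_on ({0..1} \<times> UNIV \<times> \<Theta>) (\<lambda>(t, x, p). a t x p)"
    and "\<And>t x p. t \<in> {0..1} \<Longrightarrow> p \<in> \<Theta> \<Longrightarrow> a t x p \<ge> 0"
    and "\<beta> > 0"
    and "borel_prob_on {0..1} \<nu>"
    and "borel_prob_on \<Theta> \<mu>"
    and "\<And>N j. N \<ge> 1 \<Longrightarrow> j \<in> {1..N} \<Longrightarrow> \<theta> N j \<in> \<Theta>"
    and "\<And>N j. N \<ge> 1 \<Longrightarrow> j \<in> {1..N} \<Longrightarrow> \<alpha> N j > 0"
    and "\<And>N. N \<ge> 1 \<Longrightarrow> (\<Sum>j=1..N. \<alpha> N j) = 1"
    and "weak_star_converges \<Theta> \<mu>N \<mu>"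
    and "\<rho> > 0"
    and "\<And>u. u \<in> L2_controls \<Longrightarrow> J u = (INF v\<in>L2_controls. J v) \<Longrightarrow> L2_norm u \<le> \<rho>"
  shows "Gamma_converges (subtopology weak_L2 {u \<in> L2_controls. L2_norm u \<le> \<rho>})
           (\<lambda>N u. ereal (ensemble_cost F0 F x0 a \<beta> \<nu> (\<mu>N N) u))
           (\<lambda>u. ereal (J u))"
proof -
  interpret control_system \<Theta> F0 F x0 L
    by unfold_locales (fact assms)+
  let ?B = "{u \<in> L2_controls. L2_norm u \<le> \<rho>} :: (real \<Rightarrow> real ^ 'k) set"
  have B: "topspace (subtopology weak_L2 ?B) = ?B" by auto
  let ?I = "\<lambda>N u. \<integral>p. (\<integral>t. a t (trajectory F0 F x0 u p t) p \<partial>\<nu>) \<partial>\<mu>N N"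
  let ?Ilim = "\<lambda>u. \<integral>p. (\<integral>t. a t (trajectory F0 F x0 u p t) p \<partial>\<nu>) \<partial>\<mu>"
  \<comment> \<open>Only eventually: at N = 0 the sum of atoms is empty and gives the zero
    measure.\<close>
  have \<mu>N: "\<forall>\<^sub>F N in sequentially. borel_prob_on \<Theta> (\<mu>N N)"
    using eventually_ge_at_top[of 1]
  proof eventually_elim
    case (elim N)
    show ?case
      unfolding \<mu>N_def using elim assms by (intro borel_prob_on_atomic_measure) auto
  qed
  have conv: "(\<lambda>N. ?I N (uN N)) \<longlonglongrightarrow> ?Ilim u" if "\<And>N. uN N \<in> ?B" "limitin weak_L2 uN u sequentially" for uN u
    using that assms(8) \<open>borel_prob_on {0..1} \<nu>\<close> \<mu>N \<open>weak_star_converges \<Theta> \<mu>N \<mu>\<close>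
    by (intro running_cost_tendsto[where r = \<rho>]) (auto simp: limitin_weak_L2)
  show ?thesis
    unfolding Gamma_converges_def B
  proof (intro conjI allI impI ballI)
    fix uN :: "nat \<Rightarrow> real \<Rightarrow> real ^ 'k" and u
    assume uN: "\<forall>N. uN N \<in> ?B" and "limitin (subtopology weak_L2 ?B) uN u sequentially"
    then have lim: "limitin weak_L2 uN u sequentially" by (simp add: limitin_subtopology)
    then have u: "u \<in> L2_controls" and weak: "(\<lambda>N. L2_inner (uN N) u) \<longlonglongrightarrow> L2_inner u u"
      by (auto simp: limitin_weak_L2)
    \<comment> \<open>The cost with its squared norm replaced by the affine minorant touching at u:
      it lies below the cost for every N and, unlike the cost, converges to \<open>J u\<close> under
      weak convergence alone.\<close>
    define b where "b N = ?I N (uN N) + \<beta> / 2 * (2 * L2_inner (uN N) u - (L2_norm u)\<^sup>2)" for N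
    have "b \<longlonglongrightarrow> ?Ilim u + \<beta> / 2 * (2 * L2_inner u u - (L2_norm u)\<^sup>2)"
      unfolding b_def[abs_def] using uN lim by (intro tendsto_intros conv weak) auto
    then have "b \<longlonglongrightarrow> J u"
      by (simp add: J_def ensemble_cost_def L2_inner_self)
    then have "ereal (J u) = liminf (\<lambda>N. ereal (b N))"
      by (intro lim_imp_Liminf[symmetric]) auto
    also have "\<dots> \<le> liminf (\<lambda>N. ereal (ensemble_cost F0 F x0 a \<beta> \<nu> (\<mu>N N) (uN N)))"
    proof (intro Liminf_mono always_eventually allI)
      fix N
      show "ereal (b N) \<le> ereal (ensemble_cost F0 F x0 a \<beta> \<nu> (\<mu>N N) (uN N))"
        unfolding b_def ensemble_cost_def ereal_less_eq
        using uN u \<open>\<beta> > 0\<close> by (intro add_left_mono mult_left_mono L2_norm_weak_lower_bound) auto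
    qed
    finally show "ereal (J u) \<le> liminf (\<lambda>N. ereal (ensemble_cost F0 F x0 a \<beta> \<nu> (\<mu>N N) (uN N)))" .
  next
    fix u assume u: "u \<in> ?B"
    then have lim: "limitin weak_L2 (\<lambda>_. u) u sequentially" by (simp add: limitin_weak_L2)
    have "(\<lambda>N. ensemble_cost F0 F x0 a \<beta> \<nu> (\<mu>N N) u) \<longlonglongrightarrow> J u"
      unfolding J_def ensemble_cost_def using conv[OF _ lim] u by (intro tendsto_intros) auto
    then have "limsup (\<lambda>N. ereal (ensemble_cost F0 F x0 a \<beta> \<nu> (\<mu>N N) u)) = ereal (J u)"
      by (intro lim_imp_Limsup) auto
    then show "\<exists>uN. (\<forall>N. uN N \<in> ?B) \<and> limitin (subtopology weak_L2 ?B) uN u sequentially \<and>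
        limsup (\<lambda>N. ereal (ensemble_cost F0 F x0 a \<beta> \<nu> (\<mu>N N) (uN N))) \<le> ereal (J u)"
      using u lim by (intro exI[of _ "\<lambda>_. u"]) (simp add: limitin_subtopology)
  qed
qed

end
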